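(* Let $d\in\mathbb N$, $\gamma\in\mathbb R$ and $\alpha>1$ satisfy $\alpha>\alpha_F(\gamma)=1+\frac{2+\gamma}d$. Let $q\in[1,\infty]$ and $l\in\mathbb R$ satisfy $$\frac ld+\frac1q>\frac1{q_c(\gamma)}:=\frac{2+\gamma}{d(\alpha-1)}.$$ Then there exists an initial datum $u_0\in L^{q,1}_l(\mathbb R^d)$ (with $L^{q,1}_l$ read as $L^\infty_l$ when $q=\infty$) such that the problem $\partial_tu-\Delta u=|x|^\gamma|u|^{\alpha-1}u$, $u(0)=u_0$, has no local positive weak solution, i.e. for no $T>0$ does there exist a positive weak solution on $[0,T)\times\mathbb R^d$.
   Context: $L^{q,1}_l(\mathbb R^d)$ is the set of measurable $f$ with $\|f\|_{L^{q,1}_l}=\||\cdot|^lf\|_{L^{q,1}}<\infty$, where $\|g\|_{L^{q,1}}=\int_0^\infty t^{1/q}g^*(t)\frac{dt}t$ and $g^*$ is the decreasing rearrangement of $g$; $\|f\|_{L^q_l}=\||\cdot|^lf\|_{L^q}$. $L^q_{l,loc}(\mathbb R^d)$ is the set of measurable $f$ with $f|_K\in L^q_l$ for every compact $K\subset\mathbb R^d$. Weak solution: for $T\in(0,\infty]$, a function $u:[0,T)\times\mathbb R^d\to\mathbb C$ is a weak solution of $\partial_tu-\Delta u=|x|^\gamma|u|^{\alpha-1}u$, $u(0)=u_0$, if $u\in L^\alpha(0,T;L^\alpha_{\gamma/\alpha,loc}(\mathbb R^d))$ and $$\int_{\mathbb R^d}u(T',x)\eta(T',x)\,dx-\int_{\mathbb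 R^d}u_0(x)\eta(0,x)\,dx=\int_{[0,T']\times\mathbb R^d}\big\{u(\partial_t\eta+\Delta\eta)+|x|^\gamma|u|^{\alpha-1}u\,\eta\big\}\,dx\,dt$$ for all $T'\in[0,T)$ and all $\eta\in C^{1,2}([0,T)\times\mathbb R^d)$ such that $\operatorname{supp}\eta(t,\cdot)$ is compact in $\mathbb R^d$ for each $t\in[0,T)$. *)

theory Defs
  imports "HOL-Analysis.Analysis"
begin

text \<open>
  The space \<open>R\<^sup>d\<close> is \<open>real ^ 'n\<close> with \<open>d = CARD('n)\<close>. The weight \<open>|x|\<^sup>l\<close> is written
  \<open>norm x powr l\<close>; the two can differ only at the null set \<open>x = 0\<close>.
\<close>

definition decr_rearr :: "(real ^ 'n \<Rightarrow> complex) \<Rightarrow> real \<Rightarrow> ennreal" where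
  "decr_rearr g t =
     Inf {ennreal s | s. 0 \<le> s \<and> emeasure lebesgue {x. norm (g x) > s} \<le> ennreal t}"

definition lorentz_norm :: "real \<Rightarrow> (real ^ 'n \<Rightarrow> complex) \<Rightarrow> ennreal" where
  "lorentz_norm q g =
     (\<integral>\<^sup>+t\<in>{0<..}. ennreal (t powr (1 / q) / t) * decr_rearr g t \<partial>lborel)"

definition weighted :: "real \<Rightarrow> (real ^ 'n \<Rightarrow> complex) \<Rightarrow> real ^ 'n \<Rightarrow> complex" where
  "weighted l f = (\<lambda>x. of_real (norm x powr l) * f x)"

text \<open>For \<open>q = \<infinity>\<close> the space \<open>L\<^sup>q\<^sup>,\<^sup>1\<close> with weight is read as \<open>L\<^sup>\<infinity>\<close> with the same weight.\<close>

definition weighted_lorentz :: "ereal \<Rightarrow> real \<Rightarrow> (real ^ 'n \<Rightarrow> complex) set" where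
  "weighted_lorentz q l = {f. f \<in> borel_measurable lebesgue \<and>
     (if q = \<infinity> then (\<exists>C. AE x in lebesgue. norm (weighted l f x) \<le> C)
      else lorentz_norm (real_of_ereal q) (weighted l f) < \<infinity>)}"

definition time_interval :: "ereal \<Rightarrow> real set" where
  "time_interval T = {t. 0 \<le> t \<and> ereal t < T}"

text \<open>
  The space \<open>L\<^sup>\<alpha>(0,T; L\<^sup>\<alpha>)\<close> with spatial weight \<open>|x|\<^sup>l\<close>, local in space. The inner integral is
  the \<open>\<alpha>\<close>-th power of the weighted norm of the restriction of \<open>u(t)\<close> to \<open>K\<close>.
\<close>

definition Lp_time_weighted_loc ::
    "real \<Rightarrow> real \<Rightarrow> ereal \<Rightarrow> (real \<Rightarrow> real ^ 'n \<Rightarrow> complex) set" where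
  "Lp_time_weighted_loc \<alpha> l T = {u.
     (\<lambda>(t, x). u t x) \<in> borel_measurable (lebesgue_on (time_interval T \<times> UNIV)) \<and>
     (\<forall>K. compact K \<longrightarrow>
       (\<integral>\<^sup>+t\<in>time_interval T.
          (\<integral>\<^sup>+x\<in>K. ennreal (norm (weighted l (u t) x) powr \<alpha>) \<partial>lebesgue) \<partial>lebesgue) < \<infinity>)}"

definition dt :: "ereal \<Rightarrow> (real \<Rightarrow> real ^ 'n \<Rightarrow> real) \<Rightarrow> real \<Rightarrow> real ^ 'n \<Rightarrow> real" where
  "dt T \<eta> t x = vector_derivative (\<lambda>s. \<eta> s x) (at t within time_interval T)"

definition dx :: "'n \<Rightarrow> (real ^ 'n \<Rightarrow> real) \<Rightarrow> real ^ 'n \<Rightarrow> real" where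
  "dx i f x = deriv (\<lambda>h. f (x + h *\<^sub>R axis i 1)) 0"

definition has_dx :: "'n \<Rightarrow> (real ^ 'n \<Rightarrow> real) \<Rightarrow> bool" where
  "has_dx i f \<longleftrightarrow> (\<forall>x. (\<lambda>h. f (x + h *\<^sub>R axis i 1)) field_differentiable (at 0))"

definition laplacian :: "(real ^ 'n \<Rightarrow> real) \<Rightarrow> real ^ 'n \<Rightarrow> real" where
  "laplacian f x = (\<Sum>i\<in>UNIV. dx i (dx i f) x)"

definition C12 :: "ereal \<Rightarrow> (real \<Rightarrow> real ^ 'n \<Rightarrow> real) set" where
  "C12 T = {\<eta>. let Q = time_interval T \<times> (UNIV :: (real ^ 'n) set) in
     (\<forall>t\<in>time_interval T. \<forall>x. (\<lambda>s. \<eta> s x) differentiable (at t within time_interval T)) \<and>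
     (\<forall>t\<in>time_interval T. \<forall>i. has_dx i (\<eta> t) \<and> (\<forall>j. has_dx j (dx i (\<eta> t)))) \<and>
     continuous_on Q (\<lambda>(t, x). \<eta> t x) \<and>
     continuous_on Q (\<lambda>(t, x). dt T \<eta> t x) \<and>
     (\<forall>i. continuous_on Q (\<lambda>(t, x). dx i (\<eta> t) x)) \<and>
     (\<forall>i j. continuous_on Q (\<lambda>(t, x). dx j (dx i (\<eta> t)) x))}"

definition test_functions :: "ereal \<Rightarrow> (real \<Rightarrow> real ^ 'n \<Rightarrow> real) set" where
  "test_functions T =
     {\<eta> \<in> C12 T. \<forall>t\<in>time_interval T. compact (closure {x. \<eta> t x \<noteq> 0})}"

definition weak_integrand ::
    "real \<Rightarrow> real \<Rightarrow> ereal \<Rightarrow> (real \<Rightarrow> real ^ 'n \<Rightarrow> complex) \<Rightarrow> (real \<Rightarrow> real ^ 'n \<Rightarrow> real) \<Rightarrow>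
     real \<times> (real ^ 'n) \<Rightarrow> complex" where
  "weak_integrand \<gamma> \<alpha> T u \<eta> = (\<lambda>(t, x).
     u t x * of_real (dt T \<eta> t x + laplacian (\<eta> t) x) +
     of_real (norm x powr \<gamma> * norm (u t x) powr (\<alpha> - 1)) * u t x * of_real (\<eta> t x))"

text \<open>
  The spatial supports of a test function are compact for each \<open>t\<close>, but they may escape to
  infinity as \<open>t\<close> approaches some time in \<open>[0, T']\<close>, and then the space-time integral can
  diverge. The identity is required of exactly those test functions for which this integral
  converges. If the supports for \<open>t \<in> [0, T']\<close> lie in one compact set and \<open>\<gamma> < d (\<alpha> - 1)\<close>,
  convergence follows from the integrability condition on \<open>u\<close> by the Hoelder inequality.
  Convergence of the two spatial integrals is part of the notion; it is stated explicitly
  because the integral of a non-integrable function is \<open>0\<close> by convention.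
\<close>

definition weak_solution ::
    "real \<Rightarrow> real \<Rightarrow> (real ^ 'n \<Rightarrow> complex) \<Rightarrow> ereal \<Rightarrow> (real \<Rightarrow> real ^ 'n \<Rightarrow> complex) \<Rightarrow> bool" where
  "weak_solution \<gamma> \<alpha> u0 T u \<longleftrightarrow>
     u \<in> Lp_time_weighted_loc \<alpha> (\<gamma> / \<alpha>) T \<and>
     (\<forall>T'\<in>time_interval T. \<forall>\<eta>\<in>test_functions T.
        set_integrable lebesgue ({0..T'} \<times> UNIV) (weak_integrand \<gamma> \<alpha> T u \<eta>) \<longrightarrow>
        integrable lebesgue (\<lambda>x. u T' x * of_real (\<eta> T' x)) \<and>
        integrable lebesgue (\<lambda>x. u0 x * of_real (\<eta> 0 x)) \<and>
        (\<integral>x. u T' x * of_real (\<eta> T' x) \<partial>lebesgue) - (\<integral>x. u0 x * of_real (\<eta> 0 x) \<partial>lebesgue) =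
          set_lebesgue_integral lebesgue ({0..T'} \<times> UNIV) (weak_integrand \<gamma> \<alpha> T u \<eta>))"

text \<open>Positivity means \<open>u \<ge> 0\<close> almost everywhere.\<close>

definition positive_weak_solution ::
    "real \<Rightarrow> real \<Rightarrow> (real ^ 'n \<Rightarrow> complex) \<Rightarrow> ereal \<Rightarrow> (real \<Rightarrow> real ^ 'n \<Rightarrow> complex) \<Rightarrow> bool" where
  "positive_weak_solution \<gamma> \<alpha> u0 T u \<longleftrightarrow>
     weak_solution \<gamma> \<alpha> u0 T u \<and>
     (AE (t, x) in lebesgue_on (time_interval T \<times> UNIV). u t x \<in> \<real>\<^sub>\<ge>\<^sub>0)"

end

theory Submission
  imports Defs
begin

text \<open>
  The datum is \<open>norm x powr (- k)\<close> on the unit ball, with \<open>k\<close> strictly larger than the scaling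
  exponent \<open>\<kappa> = (2 + \<gamma>) / (\<alpha> - 1)\<close>; the hypothesis on \<open>l\<close> and \<open>q\<close> leaves room for such a \<open>k\<close>.
  Suppose that a positive weak solution exists. Test it up to time \<open>r\<^sup>2\<close> with the function
  \<open>\<eta>(t, x) = D\<^sup>m\<close>, where \<open>D\<close> is the product of the positive parts of \<open>1 - t / r\<^sup>2\<close> and
  \<open>1 - |x|\<^sup>2 / r\<^sup>2\<close>. It vanishes at the final time, and its heat operator is bounded by
  \<open>const * r\<^sup>-\<^sup>2 * D\<^sup>m\<^sup>-\<^sup>2\<close>. Young's inequality absorbs the linear term into the nonlinear
  one and leaves \<open>\<integral> u0 \<eta>(0) \<le> C * r powr (d - \<kappa>)\<close> for all small \<open>r\<close>. The part of the integral
  over the annulus \<open>r / 4 < |x| \<le> r / 2\<close> alone is at least \<open>c * r powr (d - k)\<close>, which is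
  impossible as \<open>r\<close> tends to \<open>0\<close>.
\<close>


section \<open>Powers of the positive part and radial bumps\<close>

definition pospow :: "nat \<Rightarrow> real \<Rightarrow> real" where
  "pospow m s = max 0 s ^ m"

lemma pospow_nonneg [simp]: "0 \<le> pospow m s"
  by (simp add: pospow_def)

lemma continuous_on_pospow [continuous_intros]:
  "continuous_on S f \<Longrightarrow> continuous_on S (\<lambda>x. pospow m (f x))"
  unfolding pospow_def by (intro continuous_intros)

text \<open>Away from \<open>0\<close> the function agrees locally with \<open>s ^ m\<close> or with
  \<open>0\<close>, and at \<open>0\<close> the two pieces meet with derivative \<open>0\<close>
  because \<open>m - 1 \<ge> 1\<close>. This is what makes truncated polynomials usable as test
  functions once \<open>m\<close> is large enough.\<close>

lemma DERIV_pospow: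
  assumes "m \<ge> 2"
  shows "(pospow m has_real_derivative real m * pospow (m - 1) s) (at s)"
proof -
  consider "s > 0" | "s < 0" | "s = 0" by linarith
  then show ?thesis
  proof cases
    case 1
    have "((\<lambda>s. s ^ m) has_real_derivative real m * pospow (m - 1) s) (at s)"
      using 1 by (auto intro!: derivative_eq_intros simp: pospow_def)
    moreover have "\<forall>\<^sub>F t in nhds s. t > 0"
      using 1 eventually_nhds_in_open[of "{0<..}" s] by simp
    hence "\<forall>\<^sub>F t in nhds s. t ^ m = pospow m t"
      by eventually_elim (simp add: pospow_def)
    ultimately show ?thesis
      by (simp add: DERIV_cong_ev[of s s "\<lambda>s. s ^ m" "pospow m"])
  next
    case 2
    have "((\<lambda>s. 0) has_real_derivative real m * pospow (m - 1) s) (at s)"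
      using 2 assms by (simp add: pospow_def zero_power)
    moreover have "\<forall>\<^sub>F t in nhds s. t < 0"
      using 2 eventually_nhds_in_open[of "{..<0}" s] by simp
    hence "\<forall>\<^sub>F t in nhds s. 0 = pospow m t"
      using assms by (auto elim!: eventually_mono simp: pospow_def zero_power)
    ultimately show ?thesis
      by (simp add: DERIV_cong_ev[of s s "\<lambda>s. 0" "pospow m"])
  next
    case 3
    have "isCont (pospow (m - 1)) 0"
      unfolding pospow_def by (intro continuous_intros)
    moreover have "pospow (m - 1) 0 = 0"
      using assms by (simp add: pospow_def)
    ultimately have "(pospow (m - 1) \<longlongrightarrow> 0) (at 0)"
      by (simp add: isCont_def)
    \<comment> \<open>On both sides of \<open>0\<close> the difference quotient is again a truncated
      power, so its limit follows from the continuity of \<open>pospow (m - 1)\<close>.\<close>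
    moreover have "pospow (m - 1) h = (pospow m (0 + h) - pospow m 0) / h" if "h \<noteq> 0" for h
      using that assms by (cases m) (auto simp: pospow_def max_def)
    hence "\<forall>\<^sub>F h in at 0. pospow (m - 1) h = (pospow m (0 + h) - pospow m 0) / h"
      by (simp add: eventually_at_filter)
    ultimately have "(\<lambda>h. (pospow m (0 + h) - pospow m 0) / h) \<midarrow>0\<rightarrow> 0"
      by (rule Lim_transform_eventually)
    then show ?thesis
      using 3 assms \<open>pospow (m - 1) 0 = 0\<close> by (simp add: DERIV_def)
  qed
qed

lemmas DERIV_pospow_chain [derivative_intros] = DERIV_chain2[OF DERIV_pospow]

lemma inner_add_axis:
  fixes x :: "real ^ 'n"
  shows "(x + h *\<^sub>R axis i 1) \<bullet> (x + h *\<^sub>R axis i 1) = x \<bullet> x + 2 * h * x $ i + h ^ 2"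
  by (simp add: inner_add_left inner_add_right inner_axis inner_axis' inner_commute
      power2_eq_square algebra_simps)

text \<open>Written with \<open>x \<bullet> x\<close>, so that the argument of the positive part is
  polynomial in \<open>x\<close> and causes no singularity at the origin. For \<open>c > 0\<close>
  and positive \<open>m\<close> the support is the closed ball of radius
  \<open>1 / sqrt c\<close>.\<close>

definition bump :: "real \<Rightarrow> nat \<Rightarrow> real ^ 'n \<Rightarrow> real" where
  "bump c m x = pospow m (1 - c * (x \<bullet> x))"

lemma bump_nonneg [simp]: "0 \<le> bump c m x"
  by (simp add: bump_def)

lemma continuous_on_bump [continuous_intros]:
  "continuous_on S f \<Longrightarrow> continuous_on S (\<lambda>x. bump c m (f x))"
  unfolding bump_def by (intro continuous_intros)

lemma bump_eq_0_iff: "m \<noteq> 0 \<Longrightarrow> c > 0 \<Longrightarrow> bump c m x = 0 \<longleftrightarrow> 1 / c \<le> norm x ^ 2"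
  by (auto simp: bump_def pospow_def power2_norm_eq_inner field_simps max_def)

lemma DERIV_bump:
  assumes "m \<ge> 2"
  shows "((\<lambda>h. bump c m (x + h *\<^sub>R axis i 1)) has_real_derivative
           - 2 * c * real m * bump c (m - 1) x * x $ i) (at 0)"
  unfolding bump_def inner_add_axis
  using assms by (auto intro!: derivative_eq_intros)

text \<open>A first derivative of a bump is a lower bump times a coordinate, so second derivatives
  are obtained from the product rule in this form.\<close>

lemma DERIV_bump_component:
  assumes "m \<ge> 2"
  shows "((\<lambda>h. bump c m (x + h *\<^sub>R axis j 1) * (x + h *\<^sub>R axis j 1) $ i) has_real_derivative
           - 2 * c * real m * bump c (m - 1) x * x $ j * x $ i + bump c m x * axis j 1 $ i) (at 0)"
proof -
  have "((\<lambda>h. (x + h *\<^sub>R axis j 1) $ i) has_real_derivative axis j 1 $ i) (at 0)"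
    by (auto intro!: derivative_eq_intros)
  from DERIV_mult[OF DERIV_bump[OF assms, of c x j] this] show ?thesis
    by (simp add: algebra_simps)
qed

text \<open>The equation is between functions so that \<open>dx\<close> can be applied to it once
  more. The factor \<open>a\<close> later holds the time factor of the cutoff, which is constant in
  \<open>x\<close>.\<close>

lemma dx_cmult_bump:
  assumes "m \<ge> 2"
  shows "dx i (\<lambda>x. a * bump c m x) = (\<lambda>x. a * (- 2 * c * real m) * (bump c (m - 1) x * x $ i))"
    and "has_dx i (\<lambda>x. a * bump c m x)"
proof -
  have *: "((\<lambda>h. a * bump c m (x + h *\<^sub>R axis i 1)) has_real_derivative
     a * (- 2 * c * real m) * (bump c (m - 1) x * x $ i)) (at 0)" for x
    using DERIV_cmult[OF DERIV_bump[OF assms, of c x i], of a] by (simp add: algebra_simps)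
  show "dx i (\<lambda>x. a * bump c m x) = (\<lambda>x. a * (- 2 * c * real m) * (bump c (m - 1) x * x $ i))"
    unfolding dx_def using DERIV_imp_deriv[OF *] by blast
  show "has_dx i (\<lambda>x. a * bump c m x)"
    unfolding has_dx_def field_differentiable_def using * by blast
qed

lemma dx_cmult_bump_component:
  assumes "m \<ge> 2"
  shows "dx j (\<lambda>x. a * (bump c m x * x $ i)) =
      (\<lambda>x. a * (- 2 * c * real m * bump c (m - 1) x * x $ j * x $ i + bump c m x * axis j 1 $ i))"
    and "has_dx j (\<lambda>x. a * (bump c m x * x $ i))"
proof -
  note * = DERIV_cmult[OF DERIV_bump_component[OF assms], of a]
  show "dx j (\<lambda>x. a * (bump c m x * x $ i)) =
      (\<lambda>x. a * (- 2 * c * real m * bump c (m - 1) x * x $ j * x $ i + bump c m x * axis j 1 $ i))"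
    unfolding dx_def using DERIV_imp_deriv[OF *] by blast
  show "has_dx j (\<lambda>x. a * (bump c m x * x $ i))"
    unfolding has_dx_def field_differentiable_def using * by blast
qed

lemma laplacian_cmult_bump:
  fixes x :: "real ^ 'n"
  assumes "m \<ge> 3"
  shows "laplacian (\<lambda>x. a * bump c m x) x =
     a * (4 * c\<^sup>2 * real m * real (m - 1) * bump c (m - 2) x * (x \<bullet> x)
          - 2 * c * real m * real CARD('n) * bump c (m - 1) x)"
proof -
  have m: "m \<ge> 2" "m - 1 \<ge> 2" "m - 1 - 1 = m - 2" using assms by auto
  \<comment> \<open>Only diagonal second derivatives enter, where \<open>axis i 1 $ i = 1\<close>.
    The squared coordinates add up to \<open>x \<bullet> x\<close> and the constant terms to the
    dimension.\<close>
  have "laplacian (\<lambda>x. a * bump c m x) x =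
    (\<Sum>i\<in>UNIV. a * (- 2 * c * real m) *
      (- 2 * c * real (m - 1) * bump c (m - 2) x * (x $ i * x $ i) + bump c (m - 1) x))"
    unfolding laplacian_def dx_cmult_bump(1)[OF m(1)] dx_cmult_bump_component(1)[OF m(2)] m(3)
    by (simp add: algebra_simps)
  also have "\<dots> = a * (- 2 * c * real m) *
      (- 2 * c * real (m - 1) * bump c (m - 2) x * (x \<bullet> x) + real CARD('n) * bump c (m - 1) x)"
    by (simp only: sum_distrib_left[symmetric] sum.distrib inner_vec_def inner_real_def sum_constant)
  finally show ?thesis by (simp add: algebra_simps power2_eq_square)
qed

section \<open>The parabolic cutoff as a test function\<close>

text \<open>With \<open>c = 1 / r\<^sup>2\<close> this is adapted to the parabolic cylinder of
  height \<open>r\<^sup>2\<close> and radius \<open>r\<close>. Equal powers in time and space make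
  it a single power of the product of the two positive parts.\<close>

definition cutoff :: "real \<Rightarrow> nat \<Rightarrow> real \<Rightarrow> real ^ 'n \<Rightarrow> real" where
  "cutoff c m t x = pospow m (1 - c * t) * bump c m x"

text \<open>\<open>dt\<close> is a derivative within the interval, which is unique only at limit
  points. The interval is open on the right, so each of its times, including \<open>0\<close>, has
  some \<open>{t..b}\<close> with \<open>t < b\<close> inside the interval.\<close>

lemma time_interval_at_neq_bot:
  assumes "T > 0" "t \<in> time_interval T"
  shows "at t within time_interval T \<noteq> bot"
proof -
  obtain b where b: "t < b" "ereal b < T"
    using assms ereal_dense3[of "ereal t" T] less_ereal.simps(1)
    by (metis (mono_tags, lifting) ereal_dense2 mem_Collect_eq time_interval_def)
  have "{t..b} \<subseteq> time_interval T"
    using assms b by (auto simp: time_interval_def intro: order.strict_trans1[of _ "ereal b"])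
  moreover have "at t within {t..b} \<noteq> bot"
    using b by (simp add: at_within_Icc_at_right)
  ultimately show ?thesis
    using at_le bot.extremum_uniqueI by metis
qed

lemma dt_cutoff:
  assumes "T > 0" "t \<in> time_interval T" "m \<ge> 2"
  shows "dt T (cutoff c m) t x = - c * real m * pospow (m - 1) (1 - c * t) * bump c m x"
    and "(\<lambda>s. cutoff c m s x) differentiable (at t within time_interval T)"
proof -
  have "((\<lambda>s. cutoff c m s x) has_real_derivative
     (- c * real m * pospow (m - 1) (1 - c * t) * bump c m x)) (at t)"
    unfolding cutoff_def using assms(3) by (auto intro!: derivative_eq_intros)
  hence *: "((\<lambda>s. cutoff c m s x) has_vector_derivative
     (- c * real m * pospow (m - 1) (1 - c * t) * bump c m x)) (at t within time_interval T)"
    by (simp add: has_field_derivative_at_within has_real_derivative_iff_has_vector_derivative[symmetric])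
  show "dt T (cutoff c m) t x = - c * real m * pospow (m - 1) (1 - c * t) * bump c m x"
    unfolding dt_def
    by (rule vector_derivative_within[OF time_interval_at_neq_bot[OF assms(1,2)] *])
  show "(\<lambda>s. cutoff c m s x) differentiable (at t within time_interval T)"
    using * by (auto simp: has_vector_derivative_def differentiable_def)
qed

lemma laplacian_cutoff:
  fixes x :: "real ^ 'n"
  assumes "m \<ge> 3"
  shows "laplacian (cutoff c m t) x = pospow m (1 - c * t) *
     (4 * c\<^sup>2 * real m * real (m - 1) * bump c (m - 2) x * (x \<bullet> x)
          - 2 * c * real m * real CARD('n) * bump c (m - 1) x)"
  using laplacian_cmult_bump[OF assms] unfolding cutoff_def[abs_def] .

lemma cutoff_in_test_functions:
  assumes "T > 0" "m \<ge> 3" "c > 0"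
  shows "(cutoff c m :: real \<Rightarrow> real ^ 'n \<Rightarrow> real) \<in> test_functions T"
proof -
  have m: "m \<ge> 2" "m - 1 \<ge> 2" "m - 1 - 1 = m - 2" "m \<noteq> 0" using assms by auto
  let ?Q = "time_interval T \<times> (UNIV :: (real ^ 'n) set)"
  have eta: "cutoff c m t = (\<lambda>x. pospow m (1 - c * t) * bump c m x)" for t
    by (simp add: cutoff_def fun_eq_iff)
  have 1: "continuous_on ?Q (\<lambda>(t, x). cutoff c m t x)"
    by (simp add: cutoff_def case_prod_beta) (intro continuous_intros)
  \<comment> \<open>The closed formula for \<open>dt\<close> holds only at times of the interval, so
    continuity is shown for the formula and then transferred on \<open>?Q\<close>.\<close>
  have "continuous_on ?Q (\<lambda>p. - c * real m * pospow (m - 1) (1 - c * fst p) * bump c m (snd p))"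
    by (intro continuous_intros)
  then have 2: "continuous_on ?Q (\<lambda>(t, x). dt T (cutoff c m) t x)"
    by (rule continuous_on_eq) (auto simp: dt_cutoff[OF assms(1) _ m(1)])
  have 3: "continuous_on ?Q (\<lambda>(t, x). dx i (cutoff c m t) x)" for i :: 'n
    by (simp add: eta dx_cmult_bump[OF m(1)] case_prod_beta) (intro continuous_intros)
  have 4: "continuous_on ?Q (\<lambda>(t, x). dx j (dx i (cutoff c m t)) x)" for i j :: 'n
    unfolding eta dx_cmult_bump(1)[OF m(1)] dx_cmult_bump_component(1)[OF m(2)] case_prod_beta
    by (intro continuous_intros)
  have 5: "has_dx i (cutoff c m t)" "has_dx j (dx i (cutoff c m t))" for t and i j :: 'n
    unfolding eta dx_cmult_bump(1)[OF m(1)]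
    by (rule dx_cmult_bump(2)[OF m(1)] dx_cmult_bump_component(2)[OF m(2)])+
  have C12: "(cutoff c m :: real \<Rightarrow> real ^ 'n \<Rightarrow> real) \<in> C12 T"
    using 1 2 3 4 5 by (simp add: C12_def dt_cutoff(2)[OF assms(1) _ m(1)])
  have "compact (closure {x :: real ^ 'n. cutoff c m t x \<noteq> 0})" for t
  proof -
    have "norm x \<le> sqrt (1 / c)" if "cutoff c m t x \<noteq> 0" for x :: "real ^ 'n"
    proof -
      have "norm x ^ 2 < 1 / c"
        using that bump_eq_0_iff[OF m(4) assms(3), of x] by (auto simp: cutoff_def not_le)
      then show ?thesis by (intro real_le_rsqrt) simp
    qed
    hence "bounded {x :: real ^ 'n. cutoff c m t x \<noteq> 0}"
      by (auto simp: bounded_iff)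
    then show ?thesis
      by (simp add: compact_closure)
  qed
  then show ?thesis
    using C12 by (simp add: test_functions_def)
qed

text \<open>Differentiation costs at most two powers of either factor. Both factors lie in
  \<open>[0, 1]\<close>, so every term is dominated by \<open>D ^ (m - 2)\<close>, and each term
  carries one net factor \<open>c\<close>, in accordance with parabolic scaling.\<close>

lemma cutoff_operator_bound:
  fixes x :: "real ^ 'n"
  assumes "T > 0" "t \<in> time_interval T" "m \<ge> 3" "c > 0"
  defines "D \<equiv> max 0 (1 - c * t) * max 0 (1 - c * (x \<bullet> x))"
  shows "\<bar>dt T (cutoff c m) t x + laplacian (cutoff c m t) x\<bar>
     \<le> (real m + 4 * real m ^ 2 + 2 * real m * real CARD('n)) * c * D ^ (m - 2)"
    and "cutoff c m t x = D ^ m" "0 \<le> D" "D \<le> 1"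
proof -
  define A P where "A = max 0 (1 - c * t)" and "P = max 0 (1 - c * (x \<bullet> x))"
  have t: "0 \<le> t" using assms by (simp add: time_interval_def)
  have A: "0 \<le> A" "A \<le> 1" using t assms by (auto simp: A_def)
  have P: "0 \<le> P" "P \<le> 1" using assms by (auto simp: P_def)
  have D: "D = A * P" by (simp add: D_def A_def P_def)
  show "0 \<le> D" "D \<le> 1" using A P by (auto simp: D mult_le_one)
  show "cutoff c m t x = D ^ m"
    by (simp add: cutoff_def pospow_def bump_def D A_def P_def power_mult_distrib)
  have AP: "A ^ i * P ^ j \<le> D ^ (m - 2)" if "m - 2 \<le> i" "m - 2 \<le> j" for i j
    unfolding D power_mult_distrib using A P that by (intro mult_mono power_decreasing) auto
  have "dt T (cutoff c m) t x = - (real m * c * (A ^ (m - 1) * P ^ m))"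
    using dt_cutoff(1)[OF assms(1,2), of m c x] assms(3)
    by (simp add: pospow_def bump_def A_def P_def)
  moreover have "real m * c * (A ^ (m - 1) * P ^ m) \<le> real m * c * D ^ (m - 2)"
    using AP assms by (intro mult_left_mono) auto
  ultimately have 1: "\<bar>dt T (cutoff c m) t x\<bar> \<le> real m * c * D ^ (m - 2)"
    using A P assms by simp
  \<comment> \<open>One of the two factors \<open>c\<close> in the Laplacian is absorbed by
    \<open>x \<bullet> x\<close>: their product is at most \<open>1\<close> wherever
    \<open>P\<close> is nonzero. Where \<open>P = 0\<close> both sides vanish, since
    \<open>m - 2 \<ge> 1\<close>.\<close>
  have cxP: "c * (x \<bullet> x) * P ^ (m - 2) \<le> P ^ (m - 2)"
  proof (cases "c * (x \<bullet> x) \<le> 1")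
    case True then show ?thesis using P by (intro mult_left_le_one_le) (use assms in auto)
  next
    case False
    hence "P = 0" by (simp add: P_def)
    then show ?thesis using assms(3) by (simp add: zero_power)
  qed
  have "4 * c\<^sup>2 * real m * real (m - 1) * P ^ (m - 2) * (x \<bullet> x) * A ^ m
     = 4 * real m * real (m - 1) * c * (A ^ m * (c * (x \<bullet> x) * P ^ (m - 2)))"
    by (simp add: power2_eq_square)
  also have "\<dots> \<le> 4 * real m * real m * c * (A ^ m * P ^ (m - 2))"
    using assms A P cxP by (intro mult_mono) auto
  also have "\<dots> \<le> 4 * real m * real m * c * D ^ (m - 2)"
    using AP assms by (intro mult_left_mono) auto
  finally have 2: "4 * c\<^sup>2 * real m * real (m - 1) * P ^ (m - 2) * (x \<bullet> x) * A ^ m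
     \<le> 4 * real m * real m * c * D ^ (m - 2)" .
  have 3: "2 * real m * real CARD('n) * c * (A ^ m * P ^ (m - 1))
      \<le> 2 * real m * real CARD('n) * c * D ^ (m - 2)"
    using AP assms by (intro mult_left_mono) auto
  have "laplacian (cutoff c m t) x
     = 4 * c\<^sup>2 * real m * real (m - 1) * P ^ (m - 2) * (x \<bullet> x) * A ^ m
      - 2 * real m * real CARD('n) * c * (A ^ m * P ^ (m - 1))"
    by (simp add: laplacian_cutoff[OF assms(3)] pospow_def bump_def A_def P_def algebra_simps)
  moreover have "0 \<le> 4 * c\<^sup>2 * real m * real (m - 1) * P ^ (m - 2) * (x \<bullet> x) * A ^ m"
    "0 \<le> 2 * real m * real CARD('n) * c * (A ^ m * P ^ (m - 1))"
    using A P assms by auto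
  ultimately have "\<bar>laplacian (cutoff c m t) x\<bar>
     \<le> 4 * real m * real m * c * D ^ (m - 2) + 2 * real m * real CARD('n) * c * D ^ (m - 2)"
    using 2 3 by linarith
  with 1 show "\<bar>dt T (cutoff c m) t x + laplacian (cutoff c m t) x\<bar>
     \<le> (real m + 4 * real m ^ 2 + 2 * real m * real CARD('n)) * c * D ^ (m - 2)"
    by (simp add: algebra_simps power2_eq_square)
qed

section \<open>Integrals over products, balls and annuli, and the absorption inequality\<close>

text \<open>\<open>lebesgue\<close> on the product is the completion of the product measure, so
  Tonelli is applied to a Borel representative. For almost every \<open>t\<close> its section agrees
  with that of \<open>F\<close> almost everywhere.\<close>

lemma nn_integral_lebesgue_prod:
  fixes F :: "'a::euclidean_space \<times> 'b::euclidean_space \<Rightarrow> ennreal"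
  assumes "F \<in> borel_measurable lebesgue"
  shows "(\<integral>\<^sup>+p. F p \<partial>lebesgue) = (\<integral>\<^sup>+t. (\<integral>\<^sup>+x. F (t, x) \<partial>lebesgue) \<partial>lebesgue)"
proof -
  obtain F' where F': "F' \<in> borel_measurable lborel" "AE p in lborel. F p = F' p"
    using completion_ex_borel_measurable[OF assms] by blast
  have [measurable]: "F' \<in> borel_measurable (lborel \<Otimes>\<^sub>M lborel)"
    using F'(1) by (simp add: lborel_prod)
  have AE: "AE p in (lborel \<Otimes>\<^sub>M lborel). F p = F' p"
    unfolding lborel_prod by (rule F'(2))
  have "(\<integral>\<^sup>+p. F p \<partial>lebesgue) = (\<integral>\<^sup>+p. F' p \<partial>(lborel \<Otimes>\<^sub>M lborel))"
    by (simp add: nn_integral_completion lborel_prod nn_integral_cong_AE[OF F'(2)])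
  also have "\<dots> = (\<integral>\<^sup>+t. (\<integral>\<^sup>+x. F' (t, x) \<partial>lborel) \<partial>lborel)"
    by (rule lborel.nn_integral_fst[symmetric]) simp
  also have "\<dots> = (\<integral>\<^sup>+t. (\<integral>\<^sup>+x. F (t, x) \<partial>lborel) \<partial>lborel)"
  proof (rule nn_integral_cong_AE)
    show "AE t in lborel. (\<integral>\<^sup>+x. F' (t, x) \<partial>lborel) = (\<integral>\<^sup>+x. F (t, x) \<partial>lborel)"
      using lborel_pair.AE_pair[OF AE]
      by (rule eventually_mono) (auto intro!: nn_integral_cong_AE elim: eventually_mono)
  qed
  finally show ?thesis by (simp add: nn_integral_completion)
qed

lemma nn_integral_norm_powr_cball:
  fixes b :: real
  assumes "b < real DIM('a::euclidean_space)"
  obtains C where "C \<ge> 0"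
    "\<And>r. r > 0 \<Longrightarrow> (\<integral>\<^sup>+x\<in>cball 0 r. ennreal (norm (x :: 'a) powr (- b)) \<partial>lebesgue)
           \<le> ennreal (C * r powr (real DIM('a) - b))"
proof -
  define n where "n = real DIM('a)"
  define \<omega> where "\<omega> = unit_ball_vol n"
  define \<rho> where "\<rho> = 2 powr (- (n - b))"
  define K where "K = 2 powr \<bar>b\<bar> * \<omega>"
  have \<omega>: "\<omega> > 0" by (simp add: \<omega>_def n_def)
  have \<rho>: "0 < \<rho>" "\<rho> < 1" using assms powr_less_mono[of "- (n - b)" 0 2]
    by (auto simp: \<rho>_def n_def)
  have "(\<integral>\<^sup>+x\<in>cball 0 r. ennreal (norm (x :: 'a) powr (- b)) \<partial>lebesgue)
           \<le> ennreal (K / (1 - \<rho>) * r powr (n - b))" if r: "r > 0" for r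
  proof -
    \<comment> \<open>The ball is cut into the dyadic shells \<open>s (k + 1) < norm x \<le> s k\<close>; summing over them gives
       the scaling in \<open>r\<close> without a change of variables.\<close>
    define s where "s k = r / 2 ^ k" for k :: nat
    have s: "s k > 0" for k using r by (simp add: s_def)
    define a where "a k = 2 powr \<bar>b\<bar> * s k powr (- b)" for k
    have le: "ennreal (norm x powr (- b)) * indicator (cball 0 r) x
        \<le> (\<Sum>k. ennreal (a k) * indicator (cball 0 (s k)) x)" for x :: 'a
    proof (cases "x \<noteq> 0 \<and> norm x \<le> r")
      case True
      define k where "k = nat \<lfloor>log 2 (r / norm x)\<rfloor>"
      have ge: "log 2 (r / norm x) \<ge> 0" using True by (subst zero_le_log_cancel_iff) (use r in auto)
      have "real k \<le> log 2 (r / norm x)" "log 2 (r / norm x) < real k + 1"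
        using ge by (auto simp: k_def)
      hence "2 powr real k \<le> r / norm x" "r / norm x < 2 powr (real k + 1)"
        using True r by (simp_all add: le_log_iff log_less_iff)
      hence k: "norm x \<le> s k" "s k < 2 * norm x"
        using True by (simp_all add: s_def field_simps powr_add powr_realpow)
      \<comment> \<open>Replacing \<open>norm x\<close> by the outer radius \<open>s k\<close> of
        its shell changes the power by a factor of at most \<open>2 powr \<bar>b\<bar>\<close>,
        whatever the sign of \<open>b\<close>.\<close>
      define q where "q = s k / norm x"
      have q: "1 \<le> q" "q < 2" using k True by (auto simp: q_def field_simps)
      have "q powr b \<le> 2 powr \<bar>b\<bar>"
      proof -
        have "q powr b \<le> q powr \<bar>b\<bar>" using q by (intro powr_mono) auto
        also have "\<dots> \<le> 2 powr \<bar>b\<bar>" using q by (intro powr_mono2) auto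
        finally show ?thesis .
      qed
      hence "q powr b * s k powr (- b) \<le> a k"
        unfolding a_def by (intro mult_right_mono) auto
      moreover have "q powr b * s k powr (- b) = norm x powr (- b)"
        using s[of k] True by (simp add: q_def powr_divide powr_minus field_simps)
      ultimately have "norm x powr (- b) \<le> a k" by simp
      hence "ennreal (norm x powr (- b)) * indicator (cball 0 r) x
         \<le> ennreal (a k) * indicator (cball 0 (s k)) x"
        using k True by (simp add: ennreal_leI)
      also have "\<dots> = (\<Sum>j\<in>{k}. ennreal (a j) * indicator (cball 0 (s j)) x)"
        by (simp only: sum.insert sum.empty finite.emptyI empty_iff not_False_eq_True add_0_right)
      also have "\<dots> \<le> (\<Sum>k. ennreal (a k) * indicator (cball 0 (s k)) x)"
        by (rule sum_le_suminf) auto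
      finally show ?thesis .
    qed (auto simp: indicator_def)
    have "(\<integral>\<^sup>+x\<in>cball 0 r. ennreal (norm (x :: 'a) powr (- b)) \<partial>lebesgue)
      \<le> (\<integral>\<^sup>+x. (\<Sum>k. ennreal (a k) * indicator (cball 0 (s k)) (x :: 'a)) \<partial>lborel)"
      unfolding nn_integral_completion by (intro nn_integral_mono le)
    also have "\<dots> = (\<Sum>k. ennreal (a k) * emeasure lborel (cball (0 :: 'a) (s k)))"
    proof (subst nn_integral_suminf)
      show "(\<Sum>k. \<integral>\<^sup>+x. ennreal (a k) * indicator (cball 0 (s k)) (x :: 'a) \<partial>lborel)
        = (\<Sum>k. ennreal (a k) * emeasure lborel (cball (0 :: 'a) (s k)))"
        by (intro arg_cong[where f = suminf] ext nn_integral_cmult_indicator) simp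
    qed (intro borel_measurable_times_ennreal borel_measurable_const borel_measurable_indicator, simp)
    also have "\<dots> = (\<Sum>k. ennreal (K * r powr (n - b) * \<rho> ^ k))"
    proof -
      have "ennreal (a k) * emeasure lborel (cball (0 :: 'a) (s k))
          = ennreal (K * r powr (n - b) * \<rho> ^ k)" for k
      proof -
        have "s k = r * 2 powr (- real k)"
          by (simp add: s_def powr_minus powr_realpow field_simps)
        hence "s k powr (n - b) = r powr (n - b) * \<rho> ^ k"
          using r by (simp add: powr_mult \<rho>_def powr_powr powr_realpow[symmetric]) (simp add: algebra_simps)
        moreover have "s k powr (- b) * s k ^ DIM('a) = s k powr (n - b)"
          using s[of k] by (simp add: n_def powr_realpow[symmetric] powr_add[symmetric])
        ultimately have "a k * (\<omega> * s k ^ DIM('a)) = K * r powr (n - b) * \<rho> ^ k"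
          by (simp add: a_def K_def)
        moreover have "emeasure lborel (cball (0 :: 'a) (s k)) = ennreal (\<omega> * s k ^ DIM('a))"
          using s[of k] by (subst emeasure_cball) (auto simp: \<omega>_def n_def)
        moreover have "0 \<le> a k" "0 \<le> \<omega> * s k ^ DIM('a)"
          using s[of k] \<omega> by (auto simp: a_def)
        ultimately show ?thesis by (simp add: ennreal_mult[symmetric])
      qed
      thus ?thesis by simp
    qed
    also have "\<dots> = ennreal (K * r powr (n - b) * (1 / (1 - \<rho>)))"
      using \<rho> \<omega> by (intro suminf_ennreal_eq sums_mult geometric_sums) (auto simp: K_def)
    also have "K * r powr (n - b) * (1 / (1 - \<rho>)) = K / (1 - \<rho>) * r powr (n - b)"
      by simp
    finally show ?thesis .
  qed
  moreover have "K / (1 - \<rho>) \<ge> 0" using \<rho> \<omega> by (simp add: K_def)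
  ultimately show thesis using that unfolding n_def by blast
qed

lemma emeasure_annulus:
  assumes "r > 0"
  shows "emeasure lborel (cball (0 :: 'a::euclidean_space) (r / 2) - cball 0 (r / 4))
     = ennreal (unit_ball_vol (real DIM('a)) * ((1/2) ^ DIM('a) - (1/4) ^ DIM('a)) * r ^ DIM('a))"
proof -
  let ?w = "unit_ball_vol (real DIM('a))"
  have "emeasure lborel (cball (0 :: 'a) (r / 2) - cball 0 (r / 4))
    = emeasure lborel (cball (0 :: 'a) (r / 2)) - emeasure lborel (cball (0 :: 'a) (r / 4))"
    using assms by (intro emeasure_Diff) (auto simp: emeasure_cball)
  also have "\<dots> = ennreal (?w * (r / 2) ^ DIM('a) - ?w * (r / 4) ^ DIM('a))"
    using assms by (simp add: emeasure_cball ennreal_minus)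
  also have "?w * (r / 2) ^ DIM('a) - ?w * (r / 4) ^ DIM('a)
    = ?w * ((1/2) ^ DIM('a) - (1/4) ^ DIM('a)) * r ^ DIM('a)"
    by (simp add: power_divide field_simps)
  finally show ?thesis .
qed

text \<open>
  The condition \<open>m \<ge> 2 + 2 / (\<alpha> - 1)\<close> is what makes the exponent of \<open>D\<close> that remains after
  absorbing the nonlinear term nonnegative.
\<close>

lemma young_cutoff:
  fixes \<alpha> z w B D :: real
  assumes "\<alpha> > 1" "z \<ge> 0" "w > 0" "0 \<le> D" "D \<le> 1" "B \<ge> 0" "m \<ge> 3"
    and m: "2 + 2 / (\<alpha> - 1) \<le> real m"
  shows "z * (B * D ^ (m - 2)) - w * z powr \<alpha> * D ^ m
           \<le> B powr (\<alpha> / (\<alpha> - 1)) * w powr (- 1 / (\<alpha> - 1))"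
proof (cases "z * (B * D ^ (m - 2)) \<le> w * z powr \<alpha> * D ^ m")
  case True
  have "0 \<le> B powr (\<alpha> / (\<alpha> - 1)) * w powr (- 1 / (\<alpha> - 1))" by simp
  with True show ?thesis by linarith
next
  case False
  \<comment> \<open>What remains is the case where the linear term exceeds the nonlinear one.
    Cancelling \<open>z * D ^ (m - 2)\<close> bounds \<open>z powr (\<alpha> - 1)\<close>, and
    \<open>p\<close> is the exponent that turns this into a bound on \<open>z\<close>.\<close>
  define p where "p = 1 / (\<alpha> - 1)"
  have p: "p > 0" "\<alpha> / (\<alpha> - 1) = 1 + p" "- 1 / (\<alpha> - 1) = - p"
    using assms(1) by (auto simp: p_def field_simps)
  have nz: "z > 0" "D > 0" "B > 0"
    using False assms by (auto simp: less_le zero_power)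
  have "D ^ m = D ^ (m - 2) * D ^ 2"
    using assms(7) power_add[of D "m - 2" 2] by (simp only: le_add_diff_inverse2)
  moreover have "z powr \<alpha> = z * z powr (\<alpha> - 1)"
    using nz powr_add[of z 1 "\<alpha> - 1"] by simp
  ultimately have "z * D ^ (m - 2) * (w * z powr (\<alpha> - 1) * D ^ 2) < z * D ^ (m - 2) * B"
    using False by (simp add: algebra_simps)
  hence "w * z powr (\<alpha> - 1) * D ^ 2 < B"
    using nz by (simp add: mult_less_cancel_left_pos)
  hence "z powr (\<alpha> - 1) \<le> B * w powr (- 1) * D powr (- 2)"
    using nz assms(3) by (simp add: powr_minus field_simps)
  hence zp: "(z powr (\<alpha> - 1)) powr p \<le> (B * w powr (- 1) * D powr (- 2)) powr p"
    using p by (intro powr_mono2) auto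
  have "z \<le> B powr p * w powr (- p) * D powr (- 2 * p)"
  proof -
    have "(z powr (\<alpha> - 1)) powr p = z"
      using nz assms(1) by (simp add: powr_powr p_def)
    moreover have "(B * w powr (- 1) * D powr (- 2)) powr p
       = B powr p * (w powr (- 1)) powr p * (D powr (- 2)) powr p"
      using nz assms(3) by (simp only: powr_mult)
    ultimately show ?thesis
      using zp by (simp only: powr_powr) simp
  qed
  \<comment> \<open>The bound on \<open>z\<close> is inserted into the linear term; the subtracted
    nonlinear term is nonnegative and is dropped at the end.\<close>
  hence "z * (B * D ^ (m - 2)) \<le> (B powr p * w powr (- p) * D powr (- 2 * p)) * (B * D ^ (m - 2))"
    using nz by (intro mult_right_mono) auto
  also have "\<dots> = B powr (1 + p) * w powr (- p) * D powr (real (m - 2) - 2 * p)"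
    using nz by (simp add: powr_add powr_diff powr_realpow powr_minus field_simps)
  also have "\<dots> \<le> B powr (1 + p) * w powr (- p) * 1"
    using m nz assms by (intro mult_left_mono powr_le1) (auto simp: p_def of_nat_diff)
  finally show ?thesis
    using assms nz unfolding p
    by (smt (verit) mult_nonneg_nonneg powr_ge_zero zero_le_power mult_1_right)
qed

section \<open>The singular datum and its Lorentz norm\<close>

text \<open>The truncation to the unit ball leaves the singularity at the origin as the only
  obstacle to a finite norm. At the origin itself the value is \<open>0\<close>, by the convention
  for \<open>powr\<close>.\<close>

definition singular_datum :: "real \<Rightarrow> real ^ 'n \<Rightarrow> complex" where
  "singular_datum k x = of_real (norm x powr (- k) * indicator (ball 0 1) x)"

lemma borel_measurable_singular_datum [measurable]:
  "(singular_datum k :: real ^ 'n \<Rightarrow> complex) \<in> borel_measurable borel"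
proof -
  have [measurable]: "ball (0 :: real ^ 'n) 1 \<in> sets borel" by simp
  show ?thesis unfolding singular_datum_def by measurable
qed

lemma norm_weighted_singular_datum:
  "norm (weighted l (singular_datum k) x) = norm x powr (l - k) * indicator (ball 0 1) x"
  by (simp add: weighted_def singular_datum_def norm_mult abs_mult powr_diff powr_minus
      divide_inverse norm_inverse)

text \<open>For \<open>l < k\<close> the weighted datum decreases radially, so its superlevel sets
  lie in balls, and its value at the radius of the ball of volume \<open>t\<close> is an admissible
  level. For \<open>t > \<omega>\<close> the whole support has volume below \<open>t\<close>, hence
  the indicator.\<close>

lemma decr_rearr_singular_datum:
  fixes k l t :: real
  assumes "l < k" "t > 0"
  defines "\<omega> \<equiv> unit_ball_vol (real CARD('n))"
  shows "decr_rearr (weighted l (singular_datum k :: real ^ 'n \<Rightarrow> complex)) t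
    \<le> ennreal ((t / \<omega>) powr (- (k - l) / real CARD('n))) * indicator {0..\<omega>} t"
proof -
  let ?g = "weighted l (singular_datum k :: real ^ 'n \<Rightarrow> complex)"
  have \<omega>: "\<omega> > 0" by (simp add: \<omega>_def)
  have meas: "emeasure lebesgue (ball (0 :: real ^ 'n) r) = ennreal (\<omega> * r ^ CARD('n))"
    if "r \<ge> 0" for r
    using that by (simp add: emeasure_ball \<omega>_def)
  have le: "decr_rearr ?g t \<le> ennreal s"
    if "0 \<le> s" "{x. norm (?g x) > s} \<subseteq> ball 0 r" "r \<ge> 0" "\<omega> * r ^ CARD('n) \<le> t" for s r
  proof -
    have "emeasure lebesgue {x. norm (?g x) > s} \<le> emeasure lebesgue (ball (0 :: real ^ 'n) r)"
      using that by (intro emeasure_mono) auto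
    also have "\<dots> \<le> ennreal t"
      using that meas[of r] by (simp add: ennreal_leI)
    finally show ?thesis
      unfolding decr_rearr_def using that(1) by (intro Inf_lower) auto
  qed
  show ?thesis
  proof (cases "t \<le> \<omega>")
    case False
    have "{x. norm (?g x) > 0} \<subseteq> ball 0 1"
      by (auto simp: norm_weighted_singular_datum split: split_indicator)
    then have "decr_rearr ?g t \<le> ennreal 0"
      using False by (intro le[where r = 1]) auto
    then show ?thesis by simp
  next
    case True
    define d where "d = real CARD('n)"
    \<comment> \<open>The radius of the ball of volume \<open>t\<close>.\<close>
    define r where "r = (t / \<omega>) powr (1 / d)"
    have d: "d > 0" by (simp add: d_def)
    have r: "r > 0" using assms(2) \<omega> by (simp add: r_def)
    have "r powr d = t / \<omega>"
      using assms(2) \<omega> d by (simp add: r_def powr_powr)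
    hence "\<omega> * r ^ CARD('n) \<le> t"
      using \<omega> r by (simp add: d_def powr_realpow)
    moreover have s: "(t / \<omega>) powr (- (k - l) / d) = r powr (l - k)"
      by (simp add: r_def powr_powr)
    moreover have "{x. norm (?g x) > r powr (l - k)} \<subseteq> ball 0 r"
    proof
      fix x assume "x \<in> {x. norm (?g x) > r powr (l - k)}"
      hence *: "r powr (l - k) < norm x powr (l - k)"
        using r by (auto simp: norm_weighted_singular_datum split: split_indicator_asm)
      have "norm x < r"
      proof (rule ccontr)
        assume "\<not> norm x < r"
        hence "norm x powr (l - k) \<le> r powr (l - k)"
          using r assms by (intro powr_mono2') auto
        with * show False by simp
      qed
      thus "x \<in> ball 0 r" by simp
    qed
    ultimately show ?thesis
      using le[of "r powr (l - k)" r] r True assms(2) by (simp add: d_def[symmetric])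
  qed
qed

text \<open>By the rearrangement bound the integrand is at most a constant times
  \<open>t powr e\<close> on \<open>{0..\<omega>}\<close>, and the last hypothesis says that
  \<open>e > - 1\<close>, which is integrability at \<open>0\<close>.\<close>

lemma lorentz_norm_singular_datum:
  assumes "l < k" "1 \<le> q" "(k - l) / real CARD('n) < 1 / q"
  shows "lorentz_norm q (weighted l (singular_datum k :: real ^ 'n \<Rightarrow> complex)) < \<infinity>"
proof -
  define d \<omega> where "d = real CARD('n)" and "\<omega> = unit_ball_vol d"
  define \<beta> where "\<beta> = (k - l) / d"
  define e where "e = 1 / q - 1 - \<beta>"
  define A where "A = \<omega> powr \<beta>"
  let ?g = "weighted l (singular_datum k :: real ^ 'n \<Rightarrow> complex)"
  have \<omega>: "\<omega> > 0" by (simp add: \<omega>_def d_def)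
  have e: "e > - 1" using assms by (simp add: e_def \<beta>_def d_def)
  have "ennreal (t powr (1 / q) / t) * decr_rearr ?g t * indicator {0<..} t
      \<le> ennreal A * (ennreal (t powr e) * indicator {0..\<omega>} t)" for t
  proof (cases "t > 0")
    case True
    have "ennreal (t powr (1 / q) / t) * decr_rearr ?g t
       \<le> ennreal (t powr (1 / q) / t) * (ennreal ((t / \<omega>) powr (- (k - l) / d)) * indicator {0..\<omega>} t)"
      using decr_rearr_singular_datum[OF assms(1) True, where 'n = 'n]
      by (intro mult_left_mono) (auto simp: d_def \<omega>_def)
    also have "\<dots> = ennreal (t powr (1 / q) / t * (t / \<omega>) powr (- (k - l) / d)) * indicator {0..\<omega>} t"
      using True by (subst ennreal_mult) (auto simp only: mult.assoc intro!: divide_nonneg_nonneg powr_ge_zero)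
    also have "t powr (1 / q) / t * (t / \<omega>) powr (- (k - l) / d) = A * t powr e"
    proof -
      have "(t / \<omega>) powr (- \<beta>) = t powr (- \<beta>) * A"
        using True \<omega> by (simp add: A_def powr_divide powr_minus) (simp add: divide_inverse)
      moreover have "t powr e = t powr (1 / q) / t * t powr (- \<beta>)"
        using True powr_diff[of t "1 / q" 1] powr_add[of t "1 / q - 1" "- \<beta>"] by (simp add: e_def)
      moreover have "- (k - l) / d = - \<beta>"
        by (simp only: \<beta>_def minus_divide_left)
      ultimately show ?thesis by (simp only: mult_ac)
    qed
    finally show ?thesis
      using True by (simp add: A_def ennreal_mult mult.assoc)
  qed simp
  hence "lorentz_norm q ?g
     \<le> (\<integral>\<^sup>+t. ennreal A * (ennreal (t powr e) * indicator {0..\<omega>} t) \<partial>lborel)"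
    unfolding lorentz_norm_def by (intro nn_integral_mono)
  also have "\<dots> = ennreal A * (\<integral>\<^sup>+t. ennreal (t powr e) * indicator {0..\<omega>} t \<partial>lborel)"
    by (intro nn_integral_cmult) measurable
  also have "\<dots> = ennreal A * ennreal (\<omega> powr (e + 1) / (e + 1))"
    using nn_integral_has_integral_lebesgue'[OF _ has_integral_powr_from_0[OF e, of \<omega>]] \<omega>
    by simp
  also have "\<dots> < \<infinity>"
    by (simp add: ennreal_mult_less_top)
  finally show ?thesis .
qed

text \<open>For infinite \<open>q\<close> the weighted datum has the nonnegative exponent
  \<open>l - k\<close> and is therefore bounded by \<open>1\<close> on the unit ball. For finite
  \<open>q\<close> the Lorentz estimate applies.\<close>

lemma singular_datum_in_weighted_lorentz:
  fixes q :: ereal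
  assumes "1 \<le> q" "q = \<infinity> \<Longrightarrow> k \<le> l"
    and "q \<noteq> \<infinity> \<Longrightarrow> l < k \<and> (k - l) / real CARD('n) < real_of_ereal (1 / q)"
  shows "(singular_datum k :: real ^ 'n \<Rightarrow> complex) \<in> weighted_lorentz q l"
proof -
  have [measurable]: "(singular_datum k :: real ^ 'n \<Rightarrow> complex) \<in> borel_measurable lebesgue"
    by (rule measurable_completion) simp
  show ?thesis
  proof (cases q)
    case PInf
    have "norm (weighted l (singular_datum k :: real ^ 'n \<Rightarrow> complex) x) \<le> 1" for x
      using assms(2) PInf
      by (auto simp: norm_weighted_singular_datum split: split_indicator intro!: powr_le1)
    then show ?thesis using PInf by (auto simp: weighted_lorentz_def)
  next
    case (real q')
    have "1 \<le> q'" using assms(1) real by simp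
    hence "(k - l) / real CARD('n) < 1 / q'" using assms(3) real by (simp add: one_ereal_def)
    then show ?thesis
      using lorentz_norm_singular_datum[where 'n = 'n, of l k q'] assms real \<open>1 \<le> q'\<close>
      by (auto simp: weighted_lorentz_def)
  next
    case MInf
    then show ?thesis using assms(1) by simp
  qed
qed

section \<open>Pointwise bounds and measurability of the weak integrand\<close>

text \<open>The first bound serves to show that the weak integrand is integrable, the second to
  estimate its integral from below. In the second, positivity of \<open>u\<close> gives the
  nonlinear term the sign that lets it absorb the linear one; \<open>x \<noteq> 0\<close> keeps the
  weight positive.\<close>

lemma weak_integrand_cutoff_bound:
  fixes x :: "real ^ 'n" and \<gamma> :: real and u :: "real \<Rightarrow> real ^ 'n \<Rightarrow> complex"
  assumes "\<alpha> > 1" "T > 0" "t \<in> time_interval T" "m \<ge> 3" "2 + 2 / (\<alpha> - 1) \<le> real m"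
    and "r > 0" "x \<noteq> 0"
  defines "B \<equiv> (real m + 4 * real m ^ 2 + 2 * real m * real CARD('n)) * (1 / r\<^sup>2)"
    and "W \<equiv> weak_integrand \<gamma> \<alpha> T u (cutoff (1 / r\<^sup>2) m) (t, x)"
  shows "norm W \<le> 2 * (norm x powr \<gamma> * norm (u t x) powr \<alpha> * indicator (cball 0 r) x) +
           B powr (\<alpha> / (\<alpha> - 1)) * (norm x powr (- (\<gamma> / (\<alpha> - 1))) * indicator (cball 0 r) x)"
    and "u t x \<in> \<real>\<^sub>\<ge>\<^sub>0 \<Longrightarrow>
           - (B powr (\<alpha> / (\<alpha> - 1)) * (norm x powr (- (\<gamma> / (\<alpha> - 1))) * indicator (cball 0 r) x)) \<le> Re W"
proof -
  define z w E where "z = norm (u t x)" and "w = norm x powr \<gamma>"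
    and "E = dt T (cutoff (1 / r\<^sup>2) m) t x + laplacian (cutoff (1 / r\<^sup>2) m t) x"
  define D where "D = max 0 (1 - 1 / r\<^sup>2 * t) * max 0 (1 - 1 / r\<^sup>2 * (x \<bullet> x))"
  have c: "1 / r\<^sup>2 > 0" using assms by simp
  note cut = cutoff_operator_bound[OF assms(2,3,4) c, of x, folded D_def E_def B_def]
  have B: "B \<ge> 0" by (simp add: B_def)
  have w: "w > 0" using assms by (simp add: w_def)
  have z: "z \<ge> 0" by (simp add: z_def)
  have zz: "z powr (\<alpha> - 1) * z = z powr \<alpha>"
    using z powr_add[of z "\<alpha> - 1" 1] by (cases "z = 0") (auto simp: mult.commute)
  have W: "W = u t x * of_real E + of_real (w * z powr (\<alpha> - 1)) * u t x * of_real (D ^ m)"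
    unfolding W_def weak_integrand_def w_def z_def E_def using cut(2) by simp
  have zE: "z * \<bar>E\<bar> \<le> z * (B * D ^ (m - 2))"
    using cut(1) z by (intro mult_left_mono) auto
  have wp: "w powr (- 1 / (\<alpha> - 1)) = norm x powr (- (\<gamma> / (\<alpha> - 1)))"
    by (simp add: w_def powr_powr)
  note Y = young_cutoff[OF assms(1) z w cut(3,4) B assms(4,5), unfolded wp]
  have outside: "D = 0" if "x \<notin> cball 0 r"
  proof -
    have "r\<^sup>2 \<le> x \<bullet> x" using that assms by (simp add: power2_norm_eq_inner[symmetric] power_mono)
    thus ?thesis using assms by (simp add: D_def field_simps)
  qed
  have "norm W \<le> z * \<bar>E\<bar> + w * z powr (\<alpha> - 1) * z * D ^ m"
    unfolding W using cut(3) w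
    by (intro order_trans[OF norm_triangle_ineq]) (simp add: norm_mult norm_power z_def)
  also have "w * z powr (\<alpha> - 1) * z * D ^ m = w * z powr \<alpha> * D ^ m"
    using zz by (simp add: mult.assoc)
  finally have nW: "norm W \<le> z * (B * D ^ (m - 2)) + w * z powr \<alpha> * D ^ m"
    using zE by simp
  show "norm W \<le> 2 * (norm x powr \<gamma> * norm (u t x) powr \<alpha> * indicator (cball 0 r) x) +
           B powr (\<alpha> / (\<alpha> - 1)) * (norm x powr (- (\<gamma> / (\<alpha> - 1))) * indicator (cball 0 r) x)"
  proof (cases "x \<in> cball 0 r")
    case True
    \<comment> \<open>The factor \<open>2\<close> in the bound counts the nonlinear term once for
      itself and once for its share in the estimate of the linear term.\<close>
    have "w * z powr \<alpha> * D ^ m \<le> w * z powr \<alpha>"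
      using cut(3,4) w by (intro mult_right_le_one_le power_le_one) auto
    with nW Y True show ?thesis by (simp add: w_def z_def)
  next
    case False
    with nW outside assms(4) show ?thesis by (simp add: zero_power)
  qed
  assume "u t x \<in> \<real>\<^sub>\<ge>\<^sub>0"
  hence uz: "u t x = of_real z"
    by (auto simp: z_def nonneg_Reals_def)
  have "Re W = z * E + w * z powr (\<alpha> - 1) * z * D ^ m"
    unfolding W uz by simp
  also have "w * z powr (\<alpha> - 1) * z * D ^ m = w * z powr \<alpha> * D ^ m"
    using zz by (simp add: mult.assoc)
  finally have ReW: "Re W = z * E + w * z powr \<alpha> * D ^ m" .
  moreover have "- (z * \<bar>E\<bar>) \<le> z * E"
    using z by (simp add: abs_if mult_nonneg_nonneg)
  ultimately have lower: "w * z powr \<alpha> * D ^ m - z * (B * D ^ (m - 2)) \<le> Re W"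
    using zE by linarith
  show "- (B powr (\<alpha> / (\<alpha> - 1)) * (norm x powr (- (\<gamma> / (\<alpha> - 1))) * indicator (cball 0 r) x)) \<le> Re W"
  proof (cases "x \<in> cball 0 r")
    case True
    with lower Y show ?thesis by simp
  next
    case False
    with lower outside assms(4) show ?thesis by (simp add: zero_power)
  qed
qed

lemma sets_time_interval_Times [measurable]: "time_interval T \<times> (UNIV :: (real ^ 'n) set) \<in> sets borel"
proof -
  have "{t. ereal t < T} \<in> sets borel" by measurable
  moreover have "time_interval T = {0..} \<inter> {t. ereal t < T}" by (auto simp: time_interval_def)
  ultimately show ?thesis by (intro borel_Times) auto
qed

text \<open>The set \<open>x = 0\<close> is null in space-time. Discarding it avoids the points
  where \<open>norm x powr \<gamma>\<close> is \<open>0\<close> by convention.\<close>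

lemma AE_lebesgue_snd_neq_0: "AE p in lebesgue. snd (p :: real \<times> (real ^ 'n)) \<noteq> 0"
proof -
  have "AE p in lborel \<Otimes>\<^sub>M lborel. snd (p :: real \<times> (real ^ 'n)) \<noteq> 0"
  proof (rule lborel_pair.AE_pair_measure)
    show "{p \<in> space (lborel \<Otimes>\<^sub>M lborel). snd (p :: real \<times> (real ^ 'n)) \<noteq> 0} \<in> sets (lborel \<Otimes>\<^sub>M lborel)"
      by measurable
  qed (auto intro!: AE_I'[of "{0}"])
  thus ?thesis unfolding lborel_prod by (rule AE_completion)
qed

lemma borel_measurable_snd_lebesgue:
  fixes f :: "real ^ 'n \<Rightarrow> 'a::topological_space"
  assumes "f \<in> borel_measurable borel"
  shows "(\<lambda>p. f (snd p)) \<in> borel_measurable (lebesgue :: (real \<times> (real ^ 'n)) measure)"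
proof -
  have "(snd :: real \<times> (real ^ 'n) \<Rightarrow> _) \<in> borel_measurable borel"
    by (intro borel_measurable_continuous_onI continuous_intros)
  from measurable_compose[OF this assms] show ?thesis
    by (simp add: measurable_completion)
qed

text \<open>Measurability of \<open>u\<close> and continuity of the derivatives of
  \<open>\<eta>\<close> are given only on the time strip, so everything is first multiplied by the
  indicator of a set \<open>S\<close> inside it.\<close>

lemma weak_integrand_measurable:
  fixes u :: "real \<Rightarrow> real ^ 'n \<Rightarrow> complex"
  assumes "u \<in> Lp_time_weighted_loc \<alpha> l T" "\<eta> \<in> test_functions T" "T' \<in> time_interval T"
  defines "S \<equiv> {0..T'} \<times> (UNIV :: (real ^ 'n) set)"
  shows "(\<lambda>p. indicator S p *\<^sub>R weak_integrand \<gamma> \<alpha> T u \<eta> p) \<in> borel_measurable lebesgue"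
    and "(\<lambda>p. indicator S p *\<^sub>R u (fst p) (snd p)) \<in> borel_measurable lebesgue"
proof -
  let ?Q = "time_interval T \<times> (UNIV :: (real ^ 'n) set)"
  have SQ: "S \<subseteq> ?Q"
    using assms(3) by (auto simp: S_def time_interval_def intro: order.strict_trans1[of _ "ereal T'"])
  have S: "S \<in> sets lebesgue"
    unfolding S_def by (intro sets_completionI_sets) (auto intro!: borel_Times)
  have S': "S \<inter> space lebesgue \<in> sets lebesgue" using S by simp
  have cont: "(\<lambda>p. indicator S p *\<^sub>R f p) \<in> borel_measurable lebesgue"
    if "continuous_on ?Q f" for f :: "real \<times> (real ^ 'n) \<Rightarrow> real"
    using continuous_imp_measurable_on_sets_lebesgue[OF continuous_on_subset[OF that SQ] S]
      borel_measurable_restrict_space_iff[OF S'] by blast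
  have "(\<lambda>p. u (fst p) (snd p)) \<in> borel_measurable (lebesgue_on ?Q)"
    using assms(1) by (simp add: Lp_time_weighted_loc_def case_prod_beta')
  from measurable_restrict_mono[OF this SQ]
  show v [measurable]: "(\<lambda>p. indicator S p *\<^sub>R u (fst p) (snd p)) \<in> borel_measurable lebesgue"
    by (rule borel_measurable_restrict_space_iff[OF S', THEN iffD1])
  have C: "continuous_on ?Q (\<lambda>p. \<eta> (fst p) (snd p))" "continuous_on ?Q (\<lambda>p. dt T \<eta> (fst p) (snd p))"
    "\<And>i. continuous_on ?Q (\<lambda>p. dx i (dx i (\<eta> (fst p))) (snd p))"
    using assms(2) by (simp_all add: test_functions_def C12_def Let_def case_prod_beta')
  have [measurable]: "(\<lambda>p. indicator S p *\<^sub>R \<eta> (fst p) (snd p)) \<in> borel_measurable lebesgue"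
    by (rule cont[OF C(1)])
  have [measurable]: "(\<lambda>p. indicator S p *\<^sub>R (dt T \<eta> (fst p) (snd p) + laplacian (\<eta> (fst p)) (snd p)))
      \<in> borel_measurable lebesgue"
    unfolding laplacian_def by (intro cont continuous_intros C)
  have [measurable]: "(\<lambda>p. norm (snd p :: real ^ 'n) powr \<gamma>) \<in> borel_measurable (lebesgue :: (real \<times> (real ^ 'n)) measure)"
    by (rule borel_measurable_snd_lebesgue) measurable
  \<comment> \<open>Repeating the indicator in each factor changes nothing, since both summands
    contain a factor \<open>u\<close>.\<close>
  have "(\<lambda>p. indicator S p *\<^sub>R weak_integrand \<gamma> \<alpha> T u \<eta> p) =
    (\<lambda>p. (indicator S p *\<^sub>R u (fst p) (snd p)) *
           of_real (indicator S p *\<^sub>R (dt T \<eta> (fst p) (snd p) + laplacian (\<eta> (fst p)) (snd p))) +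
         of_real (norm (snd p) powr \<gamma> * norm (indicator S p *\<^sub>R u (fst p) (snd p)) powr (\<alpha> - 1)) *
           (indicator S p *\<^sub>R u (fst p) (snd p)) * of_real (indicator S p *\<^sub>R \<eta> (fst p) (snd p)))"
    by (auto simp: fun_eq_iff weak_integrand_def split: split_indicator)
  also have "\<dots> \<in> borel_measurable lebesgue" by measurable
  finally show "(\<lambda>p. indicator S p *\<^sub>R weak_integrand \<gamma> \<alpha> T u \<eta> p) \<in> borel_measurable lebesgue" .
qed

section \<open>Upper bound for the datum of a positive solution\<close>

text \<open>\<open>C\<close> and \<open>m\<close> are chosen before the datum, the solution and the
  radius, so that \<open>r\<close> may later tend to \<open>0\<close>. Since the cutoff vanishes at
  time \<open>r\<^sup>2\<close>, the initial integral is minus the space-time integral, and a lower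
  bound for the latter gives the estimate.\<close>

lemma weak_solution_initial_bound:
  fixes \<gamma> \<alpha> :: real
  assumes "\<alpha> > 1" "\<alpha> > 1 + (2 + \<gamma>) / real CARD('n::finite)"
  shows "\<exists>C m. \<forall>(u0 :: real ^ 'n \<Rightarrow> complex) T u r.
     positive_weak_solution \<gamma> \<alpha> u0 T u \<longrightarrow> 0 < r \<longrightarrow> ereal (r\<^sup>2) < T \<longrightarrow>
       integrable lebesgue (\<lambda>x. u0 x * of_real (bump (1 / r\<^sup>2) m x)) \<and>
       Re (\<integral>x. u0 x * of_real (bump (1 / r\<^sup>2) m x) \<partial>lebesgue)
         \<le> C * r powr (real CARD('n) - (2 + \<gamma>) / (\<alpha> - 1))"
proof -
  define b d where "b = \<gamma> / (\<alpha> - 1)" and "d = real CARD('n)"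
  \<comment> \<open>The value \<open>3\<close> provides two continuous derivatives; the other entry
    is the condition for absorption.\<close>
  define m where "m = max 3 (nat \<lceil>2 + 2 / (\<alpha> - 1)\<rceil>)"
  define K where "K = real m + 4 * real m ^ 2 + 2 * real m * d"
  have m: "m \<ge> 3" "2 + 2 / (\<alpha> - 1) \<le> real m" by (auto simp: m_def) linarith
  have d: "d > 0" by (simp add: d_def)
  \<comment> \<open>The condition that \<open>\<alpha>\<close> exceeds the Fujita exponent enters
    here: it makes \<open>norm x powr (- b)\<close> locally integrable.\<close>
  have "2 + \<gamma> < d * (\<alpha> - 1)" using assms d by (simp add: d_def field_simps)
  hence "b < d" using assms(1) by (simp add: b_def field_simps)
  then obtain C1 where C1: "C1 \<ge> 0" "\<And>r. r > 0 \<Longrightarrow>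
      (\<integral>\<^sup>+x\<in>cball 0 r. ennreal (norm (x :: real ^ 'n) powr (- b)) \<partial>lebesgue) \<le> ennreal (C1 * r powr (d - b))"
    using nn_integral_norm_powr_cball[where 'a = "real ^ 'n", of b] by (auto simp: d_def)
  define C where "C = K powr (\<alpha> / (\<alpha> - 1)) * C1"
  show ?thesis
  proof (intro exI[of _ C] exI[of _ m] allI impI conjI)
    fix u0 :: "real ^ 'n \<Rightarrow> complex" and T u and r :: real
    assume sol: "positive_weak_solution \<gamma> \<alpha> u0 T u" and r: "0 < r" "ereal (r\<^sup>2) < T"
    define c where "c = 1 / r\<^sup>2"
    define B where "B = K * c"
    define S where "S = {0..r\<^sup>2} \<times> (UNIV :: (real ^ 'n) set)"
    define W where "W = weak_integrand \<gamma> \<alpha> T u (cutoff c m)"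
    \<comment> \<open>\<open>G\<close> is the nonlinear density, integrable by the choice of the
      solution space; \<open>H\<close> is the remainder of the absorption, whose integral is bounded
      by an explicit power of \<open>r\<close>. The indicator around \<open>u\<close> in
      \<open>G\<close> secures measurability outside the time strip.\<close>
    define G H where "G p = indicator {0..r\<^sup>2} (fst p) *
        (norm (snd p) powr \<gamma> * norm (indicator S p *\<^sub>R u (fst p) (snd p)) powr \<alpha> * indicator (cball 0 r) (snd p))"
      and "H p = indicator {0..r\<^sup>2} (fst p) * (norm (snd p) powr (- b) * indicator (cball 0 r) (snd p))"
      for p :: "real \<times> (real ^ 'n)"
    have T: "T > 0"
      using r by (metis ereal_less(2) order.strict_trans zero_less_power)
    have T': "r\<^sup>2 \<in> time_interval T" using r by (simp add: time_interval_def)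
    have "0 < c" using r by (simp add: c_def)
    have test: "(cutoff c m :: real \<Rightarrow> real ^ 'n \<Rightarrow> real) \<in> test_functions T"
      by (rule cutoff_in_test_functions[OF T m(1) \<open>0 < c\<close>])
    have ws: "weak_solution \<gamma> \<alpha> u0 T u" and
      pos: "AE (t, x) in lebesgue_on (time_interval T \<times> UNIV). u t x \<in> \<real>\<^sub>\<ge>\<^sub>0"
      using sol by (auto simp: positive_weak_solution_def)
    have u: "u \<in> Lp_time_weighted_loc \<alpha> (\<gamma> / \<alpha>) T"
      using ws by (simp add: weak_solution_def)
    have tT: "t \<in> time_interval T" if "t \<in> {0..r\<^sup>2}" for t
      using that r by (auto simp: time_interval_def intro: order.strict_trans1[of _ "ereal (r\<^sup>2)"])
    note [measurable] = weak_integrand_measurable[OF u test T', folded S_def]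
    have [measurable]: "cball (0 :: real ^ 'n) r \<in> sets borel" by simp
    have meas_powr: "(\<lambda>p. norm (snd p) powr e) \<in> borel_measurable (lebesgue :: (real \<times> (real ^ 'n)) measure)" for e
      by (rule borel_measurable_snd_lebesgue) measurable
    have meas_ball: "(\<lambda>p. indicator (cball 0 r) (snd p) :: real) \<in> borel_measurable (lebesgue :: (real \<times> (real ^ 'n)) measure)"
      by (rule borel_measurable_snd_lebesgue) measurable
    have "fst \<in> borel_measurable (borel :: (real \<times> (real ^ 'n)) measure)"
      by (intro borel_measurable_continuous_onI continuous_intros)
    hence "fst \<in> borel_measurable (lebesgue :: (real \<times> (real ^ 'n)) measure)"
      by (simp add: measurable_completion)
    hence meas_time: "(\<lambda>p. indicator {0..r\<^sup>2} (fst p) :: real) \<in> borel_measurable (lebesgue :: (real \<times> (real ^ 'n)) measure)"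
      by (rule measurable_compose[of fst _ borel]) measurable
    have meas_H [measurable]: "H \<in> borel_measurable lebesgue"
      unfolding H_def[abs_def] by (intro borel_measurable_times meas_powr meas_ball meas_time)
    have "(\<lambda>p. norm (indicator S p *\<^sub>R u (fst p) (snd p)) powr \<alpha>) \<in> borel_measurable lebesgue"
      by measurable
    hence meas_G [measurable]: "G \<in> borel_measurable lebesgue"
      unfolding G_def[abs_def] by (intro borel_measurable_times meas_powr meas_ball meas_time)
    have H_nonneg: "0 \<le> H p" and G_nonneg: "0 \<le> G p" for p
      by (auto simp: H_def G_def)
    have "(\<integral>\<^sup>+p. ennreal (H p) \<partial>lebesgue)
      = (\<integral>\<^sup>+t. (\<integral>\<^sup>+x. ennreal (H (t, x)) \<partial>lebesgue) \<partial>lebesgue)"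
      by (rule nn_integral_lebesgue_prod) measurable
    also have "\<dots> \<le> (\<integral>\<^sup>+t\<in>{0..r\<^sup>2}. ennreal (C1 * r powr (d - b)) \<partial>lebesgue)"
    proof (intro nn_integral_mono)
      fix t
      have "(\<integral>\<^sup>+x. ennreal (H (t, x)) \<partial>lebesgue)
        = (\<integral>\<^sup>+x\<in>cball 0 r. ennreal (norm (x :: real ^ 'n) powr (- b)) \<partial>lebesgue)" if "t \<in> {0..r\<^sup>2}"
        using that by (intro nn_integral_cong) (auto simp: H_def split: split_indicator)
      moreover have "(\<integral>\<^sup>+x. ennreal (H (t, x)) \<partial>lebesgue) = 0" if "t \<notin> {0..r\<^sup>2}"
        using that by (simp add: H_def)
      ultimately show "(\<integral>\<^sup>+x. ennreal (H (t, x)) \<partial>lebesgue)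
          \<le> ennreal (C1 * r powr (d - b)) * indicator {0..r\<^sup>2} t"
        using C1(2)[OF r(1)] by (cases "t \<in> {0..r\<^sup>2}") auto
    qed
    also have "\<dots> = ennreal (C1 * r powr (d - b) * r\<^sup>2)"
      using C1(1) by (simp add: nn_integral_cmult_indicator ennreal_mult)
    finally have nnH: "(\<integral>\<^sup>+p. ennreal (H p) \<partial>lebesgue) \<le> ennreal (C1 * r powr (d - b) * r\<^sup>2)" .
    have intH: "integrable lebesgue H"
      using nnH H_nonneg by (intro integrableI_nonneg) (auto simp: less_top[symmetric] top_unique)
    have "ennreal (\<integral>p. H p \<partial>lebesgue) \<le> ennreal (C1 * r powr (d - b) * r\<^sup>2)"
      using nnH nn_integral_eq_integral[OF intH] H_nonneg by simp
    hence int_H: "(\<integral>p. H p \<partial>lebesgue) \<le> C1 * r powr (d - b) * r\<^sup>2"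
      using C1(1) by (subst (asm) ennreal_le_iff) auto
    \<comment> \<open>Raising the weight \<open>norm x powr (\<gamma> / \<alpha>)\<close> to the
      power \<open>\<alpha>\<close> gives \<open>norm x powr \<gamma>\<close>, so the local
      space-time condition on \<open>u\<close> controls \<open>G\<close>.\<close>
    have "(\<integral>\<^sup>+p. ennreal (G p) \<partial>lebesgue)
      = (\<integral>\<^sup>+t. (\<integral>\<^sup>+x. ennreal (G (t, x)) \<partial>lebesgue) \<partial>lebesgue)"
      by (rule nn_integral_lebesgue_prod) measurable
    also have "\<dots> \<le> (\<integral>\<^sup>+t\<in>time_interval T.
          (\<integral>\<^sup>+x\<in>cball 0 r. ennreal (norm (weighted (\<gamma> / \<alpha>) (u t) x) powr \<alpha>) \<partial>lebesgue) \<partial>lebesgue)"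
    proof (intro nn_integral_mono)
      fix t
      have "(\<integral>\<^sup>+x. ennreal (G (t, x)) \<partial>lebesgue)
        = (\<integral>\<^sup>+x\<in>cball 0 r. ennreal (norm (weighted (\<gamma> / \<alpha>) (u t) x) powr \<alpha>) \<partial>lebesgue)"
        if "t \<in> {0..r\<^sup>2}"
        using that assms(1) by (intro nn_integral_cong)
          (auto simp: G_def S_def weighted_def norm_mult powr_mult powr_powr split: split_indicator)
      moreover have "(\<integral>\<^sup>+x. ennreal (G (t, x)) \<partial>lebesgue) = 0" if "t \<notin> {0..r\<^sup>2}"
        using that by (simp add: G_def)
      ultimately show "(\<integral>\<^sup>+x. ennreal (G (t, x)) \<partial>lebesgue)
          \<le> (\<integral>\<^sup>+x\<in>cball 0 r. ennreal (norm (weighted (\<gamma> / \<alpha>) (u t) x) powr \<alpha>) \<partial>lebesgue)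
              * indicator (time_interval T) t"
        using tT by (cases "t \<in> {0..r\<^sup>2}") auto
    qed
    also have "\<dots> < \<infinity>"
      using u by (simp add: Lp_time_weighted_loc_def)
    finally have intG: "integrable lebesgue G"
      using G_nonneg by (intro integrableI_nonneg) auto
    define A where "A = B powr (\<alpha> / (\<alpha> - 1))"
    have Beq: "B = (real m + 4 * real m ^ 2 + 2 * real m * real CARD('n)) * c"
      by (simp add: B_def K_def d_def)
    have AE1: "AE p in lebesgue. norm (indicator S p *\<^sub>R W p) \<le> norm (2 * G p + A * H p)"
      using AE_lebesgue_snd_neq_0
    proof eventually_elim
      case (elim p)
      obtain t x where p: "p = (t, x)" by (cases p)
      have "norm (indicator S p *\<^sub>R W p) \<le> 2 * G p + A * H p"
      proof (cases "t \<in> {0..r\<^sup>2}")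
        case True
        then show ?thesis
          using weak_integrand_cutoff_bound(1)[OF assms(1) T tT[OF True] m r(1), of x \<gamma> u] elim
          unfolding Beq[symmetric] c_def[symmetric] b_def[symmetric] A_def[symmetric]
          by (simp add: p S_def G_def H_def W_def)
      next
        case False
        then show ?thesis by (simp add: p S_def G_def H_def)
      qed
      then show ?case by simp
    qed
    \<comment> \<open>The weak identity is demanded only when its integrand is integrable;
      domination by \<open>2 * G p + A * H p\<close> provides this.\<close>
    have intW: "integrable lebesgue (\<lambda>p. indicator S p *\<^sub>R W p)"
      by (rule Bochner_Integration.integrable_bound[OF _ _ AE1])
        (use intG intH in \<open>auto simp: W_def\<close>)
    \<comment> \<open>Positivity is known almost everywhere on the time strip; as an implication on
      the whole space it can be combined with \<open>snd p \<noteq> 0\<close>.\<close>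
    have "AE p in lebesgue. p \<in> time_interval T \<times> UNIV \<longrightarrow> u (fst p) (snd p) \<in> \<real>\<^sub>\<ge>\<^sub>0"
      using pos by (subst (asm) AE_restrict_space_iff) (auto simp: case_prod_beta intro: sets_completionI_sets)
    with AE_lebesgue_snd_neq_0
    have AE2: "AE p in lebesgue. - (A * H p) \<le> Re (indicator S p *\<^sub>R W p)"
    proof eventually_elim
      case (elim p)
      obtain t x where p: "p = (t, x)" by (cases p)
      show ?case
      proof (cases "t \<in> {0..r\<^sup>2}")
        case True
        then show ?thesis
          using weak_integrand_cutoff_bound(2)[OF assms(1) T tT[OF True] m r(1), of x u \<gamma>] elim tT[OF True]
          unfolding Beq[symmetric] c_def[symmetric] b_def[symmetric] A_def[symmetric]
          by (simp add: p S_def G_def H_def W_def)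
      next
        case False
        then show ?thesis by (simp add: p S_def G_def H_def)
      qed
    qed
    have weak: "integrable lebesgue (\<lambda>x. u0 x * of_real (cutoff c m 0 x)) \<and>
        (\<integral>x. u (r\<^sup>2) x * of_real (cutoff c m (r\<^sup>2) x) \<partial>lebesgue) - (\<integral>x. u0 x * of_real (cutoff c m 0 x) \<partial>lebesgue) =
          set_lebesgue_integral lebesgue S W"
      using ws T' test intW unfolding weak_solution_def set_integrable_def S_def W_def by blast
    have "cutoff c m 0 x = bump c m x" "cutoff c m (r\<^sup>2) x = 0" for x :: "real ^ 'n"
      using r m by (auto simp: cutoff_def pospow_def c_def zero_power)
    with weak have int0: "integrable lebesgue (\<lambda>x. u0 x * of_real (bump c m x))"
      and eq: "(\<integral>x. u0 x * of_real (bump c m x) \<partial>lebesgue) = - (\<integral>p. indicator S p *\<^sub>R W p \<partial>lebesgue)"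
      by (auto simp: set_lebesgue_integral_def minus_equation_iff)
    show "integrable lebesgue (\<lambda>x. u0 x * of_real (bump (1 / r\<^sup>2) m x))"
      using int0 by (simp add: c_def)
    have "(\<integral>p. - (A * H p) \<partial>lebesgue) \<le> (\<integral>p. Re (indicator S p *\<^sub>R W p) \<partial>lebesgue)"
      using intH intW AE2 by (intro integral_mono_AE integrable_Re) auto
    also have "\<dots> = Re (\<integral>p. indicator S p *\<^sub>R W p \<partial>lebesgue)"
      by (rule integral_Re[OF intW])
    finally have "Re (\<integral>x. u0 x * of_real (bump c m x) \<partial>lebesgue) \<le> A * (\<integral>p. H p \<partial>lebesgue)"
      using eq by simp
    also have "\<dots> \<le> A * (C1 * r powr (d - b) * r\<^sup>2)"
      using int_H by (intro mult_left_mono) (auto simp: A_def)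
    also have "A = K powr (\<alpha> / (\<alpha> - 1)) * r powr (- 2 * (\<alpha> / (\<alpha> - 1)))"
    proof -
      have "c = r powr (- 2)" using r by (simp add: c_def powr_minus powr_realpow divide_inverse)
      then show ?thesis using r by (simp add: A_def B_def powr_mult powr_powr)
    qed
    also have "K powr (\<alpha> / (\<alpha> - 1)) * r powr (- 2 * (\<alpha> / (\<alpha> - 1))) * (C1 * r powr (d - b) * r\<^sup>2)
       = C * r powr (- 2 * (\<alpha> / (\<alpha> - 1)) + (d - b) + 2)"
    proof -
      have "r powr (x + y + 2) = r powr x * r powr y * r\<^sup>2" for x y
        using r by (simp add: powr_add)
      then show ?thesis by (simp only: C_def mult_ac)
    qed
    \<comment> \<open>The exponents stem from the factor \<open>A\<close>, the integral over the
      ball and the length of the time interval; together they give the scaling exponent of the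
      problem.\<close>
    also have "- 2 * (\<alpha> / (\<alpha> - 1)) + (d - b) + 2 = d - (2 + \<gamma>) / (\<alpha> - 1)"
    proof -
      have "\<alpha> / (\<alpha> - 1) = 1 + 1 / (\<alpha> - 1)" using assms(1) by (simp add: field_simps)
      then show ?thesis by (simp add: b_def add_divide_distrib)
    qed
    finally show "Re (\<integral>x. u0 x * of_real (bump (1 / r\<^sup>2) m x) \<partial>lebesgue)
         \<le> C * r powr (real CARD('n) - (2 + \<gamma>) / (\<alpha> - 1))"
      by (simp add: c_def d_def)
  qed
qed

section \<open>Lower bound for the singular datum and nonexistence\<close>

text \<open>On the annulus the ratio \<open>norm x / r\<close> lies between \<open>1/4\<close> and
  \<open>1/2\<close>, so the datum is comparable to \<open>r powr (- k)\<close> and the bump is at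
  least \<open>(3/4) ^ m\<close>. Elsewhere the integrand is nonnegative, and \<open>r < 1\<close>
  keeps the annulus in the unit ball.\<close>

lemma integral_singular_datum_bump_ge:
  fixes k r :: real
  assumes r: "0 < r" "r < 1"
    and int: "integrable lebesgue (\<lambda>x :: real ^ 'n. singular_datum k x * of_real (bump (1 / r\<^sup>2) m x))"
  defines "d \<equiv> CARD('n)"
  shows "(1/4) powr \<bar>k\<bar> * (3/4) ^ m * (unit_ball_vol (real d) * ((1/2) ^ d - (1/4) ^ d)) * r powr (real d - k)
     \<le> Re (\<integral>x. singular_datum k (x :: real ^ 'n) * of_real (bump (1 / r\<^sup>2) m x) \<partial>lebesgue)"
proof -
  define R :: "(real ^ 'n) set" where "R = cball 0 (r / 2) - cball 0 (r / 4)"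
  define a where "a = (1/4) powr \<bar>k\<bar> * r powr (- k) * (3/4) ^ m"
  define v where "v = unit_ball_vol (real d) * ((1/2) ^ d - (1/4) ^ d) * r ^ d"
  have v: "v \<ge> 0" using r by (auto simp: v_def intro!: mult_nonneg_nonneg power_mono)
  have "emeasure lborel R = ennreal v"
    using emeasure_annulus[OF r(1), where 'a = "real ^ 'n"] by (simp add: R_def v_def d_def)
  moreover have R [measurable]: "R \<in> sets borel" by (simp add: R_def)
  ultimately have emR: "emeasure lebesgue R = ennreal v" by simp
  have intR: "integrable lebesgue (\<lambda>x. a * indicator R x)"
    using emR R by (intro integrable_mult_right integrable_real_indicator) auto
  have le: "a * indicator R x \<le> Re (singular_datum k x * of_real (bump (1 / r\<^sup>2) m x))" for x
  proof (cases "x \<in> R")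
    case True
    hence x: "r / 4 < norm x" "norm x \<le> r / 2" by (auto simp: R_def)
    define s where "s = norm x / r"
    have s: "1 / 4 < s" "s \<le> 1 / 2" using x r by (auto simp: s_def field_simps)
    \<comment> \<open>As the base is below \<open>1\<close>, the exponent
      \<open>\<bar>k\<bar>\<close> gives a lower bound for both signs of \<open>k\<close>.\<close>
    have "(1 / 4) powr \<bar>k\<bar> \<le> s powr \<bar>k\<bar>" using s by (intro powr_mono2) auto
    also have "\<dots> \<le> s powr (- k)" using s by (intro powr_mono') auto
    finally have "(1 / 4) powr \<bar>k\<bar> * r powr (- k) \<le> s powr (- k) * r powr (- k)"
      by (intro mult_right_mono) auto
    also have "\<dots> = norm x powr (- k)" using r by (simp add: s_def powr_mult[symmetric])
    finally have 1: "(1 / 4) powr \<bar>k\<bar> * r powr (- k) \<le> norm x powr (- k)" .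
    have "x \<bullet> x = r\<^sup>2 * s\<^sup>2" using r by (simp add: s_def power2_norm_eq_inner[symmetric] power_divide)
    moreover have "s\<^sup>2 \<le> (1 / 2)\<^sup>2" using s by (intro power_mono) auto
    ultimately have "3 / 4 \<le> 1 - 1 / r\<^sup>2 * (x \<bullet> x)" using r by (simp add: power2_eq_square)
    hence "3 / 4 \<le> max 0 (1 - 1 / r\<^sup>2 * (x \<bullet> x))"
      by (rule max.coboundedI2)
    hence "(3 / 4) ^ m \<le> bump (1 / r\<^sup>2) m x"
      unfolding bump_def pospow_def by (rule power_mono) simp
    with 1 have "a \<le> norm x powr (- k) * bump (1 / r\<^sup>2) m x"
      unfolding a_def by (intro mult_mono) auto
    moreover have "x \<in> ball 0 1" using x r by simp
    ultimately show ?thesis using True by (simp add: singular_datum_def)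
  next
    case False
    then show ?thesis by (simp add: singular_datum_def split: split_indicator)
  qed
  have "a * v = (\<integral>x. a * indicator R x \<partial>lebesgue)"
    using emR R v by (simp add: measure_def)
  also have "\<dots> \<le> (\<integral>x. Re (singular_datum k (x :: real ^ 'n) * of_real (bump (1 / r\<^sup>2) m x)) \<partial>lebesgue)"
    by (rule integral_mono[OF intR integrable_Re[OF int] le])
  also have "\<dots> = Re (\<integral>x. singular_datum k (x :: real ^ 'n) * of_real (bump (1 / r\<^sup>2) m x) \<partial>lebesgue)"
    by (rule integral_Re[OF int])
  finally have "a * v \<le> Re (\<integral>x. singular_datum k (x :: real ^ 'n) * of_real (bump (1 / r\<^sup>2) m x) \<partial>lebesgue)" .
  moreover have "r powr (real d - k) = r powr (- k) * r ^ d"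
    using r powr_add[of r "- k" "real d"] by (simp add: powr_realpow)
  ultimately show ?thesis by (simp add: a_def v_def mult_ac)
qed

theorem theorem8p7:
  fixes \<gamma> \<alpha> l :: real and q :: ereal
  assumes "\<alpha> > 1"
    and "\<alpha> > 1 + (2 + \<gamma>) / real CARD('n::finite)"
    and "1 \<le> q"
    and "l / real CARD('n) + real_of_ereal (1 / q) > (2 + \<gamma>) / (real CARD('n) * (\<alpha> - 1))"
  shows "\<exists>u0 \<in> (weighted_lorentz q l :: (real ^ 'n \<Rightarrow> complex) set).
           (AE x in lebesgue. u0 x \<in> \<real>\<^sub>\<ge>\<^sub>0) \<and>
           \<not> (\<exists>T > 0. \<exists>u. positive_weak_solution \<gamma> \<alpha> u0 T u)"
proof -
  define d \<kappa> where "d = CARD('n)" and "\<kappa> = (2 + \<gamma>) / (\<alpha> - 1)"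
  define p where "p = real_of_ereal (1 / q)"
  have d: "d > 0" by (simp add: d_def)
  have \<kappa>: "\<kappa> < l + real d * p"
  proof -
    have "\<kappa> / real d < l / real d + p"
      using assms(4) by (simp add: \<kappa>_def p_def d_def mult.commute)
    then show ?thesis using d by (simp add: field_simps)
  qed
  \<comment> \<open>For infinite \<open>q\<close> one has \<open>p = 0\<close>, so
    \<open>\<kappa> < l\<close> and \<open>k = l\<close> is possible. For finite \<open>q\<close>
    the open interval from \<open>max l \<kappa>\<close> to \<open>l + real d * p\<close> is
    nonempty.\<close>
  have "\<exists>k>\<kappa>. (q = \<infinity> \<longrightarrow> k \<le> l) \<and> (q \<noteq> \<infinity> \<longrightarrow> l < k \<and> (k - l) / real d < p)"
  proof (cases "q = \<infinity>")
    case True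
    hence "p = 0" by (simp add: p_def)
    thus ?thesis using \<kappa> True by (intro exI[of _ l]) auto
  next
    case False
    hence "p > 0" using assms(3) by (cases q) (auto simp: p_def one_ereal_def)
    hence "max l \<kappa> < l + real d * p" using \<kappa> d by simp
    then obtain k where "max l \<kappa> < k" "k < l + real d * p" using dense by blast
    thus ?thesis using False d by (intro exI[of _ k]) (auto simp: field_simps)
  qed
  then obtain k where k: "\<kappa> < k" "q = \<infinity> \<Longrightarrow> k \<le> l"
    "q \<noteq> \<infinity> \<Longrightarrow> l < k \<and> (k - l) / real CARD('n) < real_of_ereal (1 / q)"
    by (auto simp: p_def d_def)
  let ?u0 = "singular_datum k :: real ^ 'n \<Rightarrow> complex"
  obtain C m where C: "\<forall>(u0 :: real ^ 'n \<Rightarrow> complex) T u r.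
     positive_weak_solution \<gamma> \<alpha> u0 T u \<longrightarrow> 0 < r \<longrightarrow> ereal (r\<^sup>2) < T \<longrightarrow>
       integrable lebesgue (\<lambda>x. u0 x * of_real (bump (1 / r\<^sup>2) m x)) \<and>
       Re (\<integral>x. u0 x * of_real (bump (1 / r\<^sup>2) m x) \<partial>lebesgue) \<le> C * r powr (real d - \<kappa>)"
    using weak_solution_initial_bound[OF assms(1,2), folded d_def \<kappa>_def] by (elim exE)
  define c where "c = (1/4) powr \<bar>k\<bar> * (3/4) ^ m * (unit_ball_vol (real d) * ((1/2) ^ d - (1/4) ^ d))"
  have "(1/4 :: real) ^ d < (1/2) ^ d" using d by (intro power_strict_mono) auto
  hence c: "c > 0" by (simp add: c_def)
  have False if sol: "positive_weak_solution \<gamma> \<alpha> ?u0 T u" and T: "T > 0" for T u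
  proof -
    obtain \<tau> where \<tau>: "0 < \<tau>" "ereal \<tau> < T"
      using ereal_dense2[OF T] by auto
    have "((\<lambda>r. r\<^sup>2) \<longlongrightarrow> 0\<^sup>2) (at_right (0 :: real))" by (intro tendsto_intros)
    hence "\<forall>\<^sub>F r in at_right (0 :: real). r\<^sup>2 < \<tau>"
      using \<tau> by (intro order_tendstoD(2)) auto
    moreover have "((\<lambda>r. C * r powr (k - \<kappa>)) \<longlongrightarrow> C * 0 powr (k - \<kappa>)) (at_right (0 :: real))"
      using k(1) by (intro tendsto_intros tendsto_powr') (auto simp: eventually_at_right_less intro: eventually_mono[OF eventually_at_right_less])
    \<comment> \<open>The strict inequality \<open>\<kappa> < k\<close> is decisive here: the
      quotient of the upper and lower bounds tends to \<open>0\<close>.\<close>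
    hence "\<forall>\<^sub>F r in at_right (0 :: real). C * r powr (k - \<kappa>) < c"
      using c k(1) by (intro order_tendstoD(2)) auto
    moreover have "\<forall>\<^sub>F r in at_right (0 :: real). r \<in> {0<..<1}"
      by (rule eventually_at_right_real) simp
    ultimately have "\<forall>\<^sub>F r in at_right (0 :: real). r\<^sup>2 < \<tau> \<and> C * r powr (k - \<kappa>) < c \<and> r \<in> {0<..<1}"
      by eventually_elim auto
    then obtain r where r: "r\<^sup>2 < \<tau>" "C * r powr (k - \<kappa>) < c" "0 < r" "r < 1"
      using eventually_happens'[OF trivial_limit_at_right_real] by auto
    have "ereal (r\<^sup>2) < T" using r(1) \<tau>(2) by (metis ereal_less(2) less_ereal.simps(1) order.strict_trans)
    note C = C[rule_format, OF sol r(3) this]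
    have "c * r powr (real d - k) \<le> C * r powr (real d - \<kappa>)"
      using integral_singular_datum_bump_ge[OF r(3,4) conjunct1[OF C]] conjunct2[OF C]
      by (simp add: c_def d_def)
    \<comment> \<open>Cancelling the positive factor \<open>r powr (real d - k)\<close> leaves
      \<open>c \<le> C * r powr (k - \<kappa>)\<close>, against the choice of
      \<open>r\<close>.\<close>
    also have "\<dots> = C * r powr (k - \<kappa>) * r powr (real d - k)"
      by (simp add: powr_add[symmetric])
    finally show False using r by simp
  qed
  moreover have "?u0 \<in> weighted_lorentz q l"
    using singular_datum_in_weighted_lorentz[OF assms(3), of k l] k(2,3) by blast
  moreover have "AE x in lebesgue. ?u0 x \<in> \<real>\<^sub>\<ge>\<^sub>0"
    by (simp add: singular_datum_def)
  ultimately show ?thesis by blast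
qed

end
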